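(* Fix $d\ge 1$, $m>0$, a batch size $s\ge 1$ and a bound $M<\infty$. Then there exist constants $c_0>0$ and $C>0$ and, for each test function $\varphi\in C_b^\infty(\mathbb{R})$, a constant $C_\varphi>0$ (depending on $\varphi$), such that the following holds; in particular, $c_0$, $C$ and $C_\varphi$ are independent of $T$, $\Delta t$ and of the number of terms $N_J$ (equivalently, of the system size $N$). Let $\mathcal{J}$ be a finite index set of size $N_J\ge s$. Let $V_1\in C^1(\mathbb{R}^d)$ and $\psi_j\in C^2(\mathbb{R}^d)$ ($j\in\mathcal{J}$) be real-valued functions with $\|\nabla V_1\|_\infty\le M$, $\|\nabla\psi_j\|_\infty\le M$ and $\|\nabla^2\psi_j\|_\infty\le M$ for all $j\in\mathcal{J}$. Let $L\ge 1$ be an integer, $\Delta t>0$ and $T=L\Delta t$, with $T(1+T^2)\Delta t\le c_0$. Let $X^0,P^0$ be $\mathbb{R}^d$-valued random variables with $\mathbb{E}[|P^0|^4]\le M$. Let $(\boldsymbol{x},\boldsymbol{p})$ be a solution on $[0,T]$ of the full Hamiltonian system and $(\tilde{\boldsymbol{x}},\tilde{\boldsymbol{p}})$ a solution on $[0,T]$ of the random batch system (both defined in the context), with the same initial data $\boldsymbol{x}(0)=\tilde{\boldsymbol{x}}(0)=X^0$ and $\boldsymbol{p}(0)=\tilde{\boldsymbol{p}}(0)=P^0$. Then $$\big\|H(\tilde{\boldsymbol{x}}(T),\tilde{\boldsymbol{p}}(T))-H(\boldsymbol{x}(T),\boldsymbol{p}(T))\big\|\le C\sqrt{T(1+T^2)\Delta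 t},$$ and, for every $\varphi\in C_b^\infty(\mathbb{R})$, $$\Big|\mathbb{E}\big[\varphi\big(H(\tilde{\boldsymbol{x}}(T),\tilde{\boldsymbol{p}}(T))\big)-\varphi\big(H(\boldsymbol{x}(T),\boldsymbol{p}(T))\big)\big]\Big|\le C_\varphi\,T(1+T^2)\Delta t.$$
   Context: Norm: $\|\cdot\|=\sqrt{\mathbb{E}|\cdot|^2}$ is the $L^2(\Omega,\mathbb{P})$ norm on the underlying probability space $(\Omega,\mathcal{F},\mathbb{P})$; $\|\cdot\|_\infty$ is the supremum norm over $\mathbb{R}^d$. $C_b^\infty(\mathbb{R})$ denotes smooth functions that are bounded together with all their derivatives. Full Hamiltonian system: $$\dot{\boldsymbol{x}}=\frac{\boldsymbol{p}}{m},\qquad \dot{\boldsymbol{p}}=-\nabla V_1(\boldsymbol{x})+\frac1{N_J}\sum_{j\in\mathcal{J}}\nabla\psi_j(\boldsymbol{x}).$$ Its Hamiltonian, which is conserved along its solutions, is $$H(x,p)=\frac{|p|^2}{2m}+V_1(x)-\frac1{N_J}\sum_{j\in\mathcal{J}}\psi_j(x).$$ Random batches: $\xi_1,\dots,\xi_L$ are random subsets of $\mathcal{J}$, each uniformly distributed among the subsets of size $s$, and the family $\{(X^0,P^0),\xi_1,\dots,\xi_L\}$ is independent ($X^0$ and $P^0$ are also independent of each other). Random batch system: put $t_\ell=\ell\Delta t$. For $\ell=1,\dots,L$ and $t\in[t_{\ell-1},t_\ell)$, $$\dot{\tilde{\boldsymbol{x}}}=\frac{\tilde{\boldsymbol{p}}}{m},\qquad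 \dot{\tilde{\boldsymbol{p}}}=-\nabla V_1(\tilde{\boldsymbol{x}})+\frac1s\sum_{j\in\xi_\ell}\nabla\psi_j(\tilde{\boldsymbol{x}}),$$ with $(\tilde{\boldsymbol{x}},\tilde{\boldsymbol{p}})$ continuous on $[0,T]$. The dynamics is continuous in time (no time discretization); only the batch is renewed after each interval of length $\Delta t$. The solution is adapted: for $t\in[t_{\ell-1},t_\ell]$, $(\tilde{\boldsymbol{x}}(t),\tilde{\boldsymbol{p}}(t))$ is measurable with respect to $\sigma(X^0,P^0,\xi_1,\dots,\xi_\ell)$. *)

theory Defs
  imports "HOL-Probability.Probability"
begin

text \<open>Meaningful only where \<open>f\<close> is differentiable, as ensured by the predicates \<open>C1_fun\<close> and \<open>C2_fun\<close>.\<close>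

definition grad :: "('a::euclidean_space \<Rightarrow> real) \<Rightarrow> 'a \<Rightarrow> 'a" where
  "grad f x = (THE D. GDERIV f x :> D)"

lemma grad_eqI:
  assumes "GDERIV f x :> D"
  shows "grad f x = D"
  unfolding grad_def
proof (rule the_equality)
  show "GDERIV f x :> D" by (fact assms)
next
  fix E assume "GDERIV f x :> E"
  then have "(\<lambda>h. h \<bullet> E) = (\<lambda>h. h \<bullet> D)"
    using assms unfolding gderiv_def by (rule has_derivative_unique)
  then have "(E - D) \<bullet> E = (E - D) \<bullet> D" by (rule fun_cong)
  then have "(E - D) \<bullet> (E - D) = 0" by (simp only: inner_diff_right diff_self)
  then show "E = D" by simp
qed

definition hess :: "(real^'n \<Rightarrow> real) \<Rightarrow> real^'n \<Rightarrow> real^'n^'n" where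
  "hess f x = jacobian (grad f) (at x)"

definition C1_fun :: "(real^'n \<Rightarrow> real) \<Rightarrow> bool" where
  "C1_fun f \<longleftrightarrow> (\<forall>x. f differentiable (at x)) \<and> continuous_on UNIV (grad f)"

definition C2_fun :: "(real^'n \<Rightarrow> real) \<Rightarrow> bool" where
  "C2_fun f \<longleftrightarrow> C1_fun f \<and> (\<forall>x. grad f differentiable (at x)) \<and> continuous_on UNIV (hess f)"

definition Cb_smooth :: "(real \<Rightarrow> real) set" where
  "Cb_smooth = {\<phi>. \<forall>k. (\<forall>y. (deriv ^^ k) \<phi> differentiable (at y)) \<and> bounded (range ((deriv ^^ k) \<phi>))}"

definition L2_norm :: "'w measure \<Rightarrow> ('w \<Rightarrow> real) \<Rightarrow> real" where
  "L2_norm P f = sqrt (\<integral>\<omega>. \<bar>f \<omega>\<bar>\<^sup>2 \<partial>P)"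

definition Ham :: "real \<Rightarrow> (real^'n \<Rightarrow> real) \<Rightarrow> nat set \<Rightarrow> (nat \<Rightarrow> real^'n \<Rightarrow> real)
    \<Rightarrow> real^'n \<Rightarrow> real^'n \<Rightarrow> real" where
  "Ham m V J \<psi> x p = (norm p)\<^sup>2 / (2 * m) + V x - (1 / real (card J)) * (\<Sum>j\<in>J. \<psi> j x)"

definition full_solution :: "real \<Rightarrow> (real^'n \<Rightarrow> real) \<Rightarrow> nat set \<Rightarrow> (nat \<Rightarrow> real^'n \<Rightarrow> real)
    \<Rightarrow> real \<Rightarrow> (real \<Rightarrow> real^'n) \<Rightarrow> (real \<Rightarrow> real^'n) \<Rightarrow> bool" where
  "full_solution m V J \<psi> T x p \<longleftrightarrow>
     (\<forall>t\<in>{0..T}.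
        (x has_vector_derivative (1 / m) *\<^sub>R p t) (at t within {0..T}) \<and>
        (p has_vector_derivative
           - grad V (x t) + (1 / real (card J)) *\<^sub>R (\<Sum>j\<in>J. grad (\<psi> j) (x t)))
          (at t within {0..T}))"

text \<open>
  Here \<open>\<xi> l\<close> is the realised batch on the \<open>l\<close>-th interval. The momentum equation jumps at
  the grid points, so at the left endpoint of each interval the derivative is the right derivative.
\<close>

definition batch_solution :: "real \<Rightarrow> (real^'n \<Rightarrow> real) \<Rightarrow> (nat \<Rightarrow> real^'n \<Rightarrow> real) \<Rightarrow> nat
    \<Rightarrow> nat \<Rightarrow> real \<Rightarrow> (nat \<Rightarrow> nat set) \<Rightarrow> (real \<Rightarrow> real^'n) \<Rightarrow> (real \<Rightarrow> real^'n) \<Rightarrow> bool" where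
  "batch_solution m V \<psi> s L \<Delta>t \<xi> x p \<longleftrightarrow>
     continuous_on {0..real L * \<Delta>t} x \<and> continuous_on {0..real L * \<Delta>t} p \<and>
     (\<forall>l\<in>{1..L}. \<forall>t\<in>{real (l - 1) * \<Delta>t..<real l * \<Delta>t}.
        (x has_vector_derivative (1 / m) *\<^sub>R p t)
          (at t within {real (l - 1) * \<Delta>t..<real l * \<Delta>t}) \<and>
        (p has_vector_derivative
           - grad V (x t) + (1 / real s) *\<^sub>R (\<Sum>j\<in>\<xi> l. grad (\<psi> j) (x t)))
          (at t within {real (l - 1) * \<Delta>t..<real l * \<Delta>t}))"

text \<open>
  The \<open>\<sigma>\<close>-algebras generated by the members of the family \<open>(X0, P0), \<xi> 1, \<dots>, \<xi> L\<close>;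
  index \<open>0\<close> is the initial datum. They are used directly because the library's
  \<open>indep_vars\<close> requires all members of a family to take values in the same type.
\<close>

definition source_events :: "'w measure \<Rightarrow> nat set \<Rightarrow> ('w \<Rightarrow> real^'n) \<Rightarrow> ('w \<Rightarrow> real^'n)
    \<Rightarrow> (nat \<Rightarrow> 'w \<Rightarrow> nat set) \<Rightarrow> nat \<Rightarrow> 'w set set" where
  "source_events P J X0 P0 \<xi> k =
     (if k = 0 then sets (vimage_algebra (space P) (\<lambda>\<omega>. (X0 \<omega>, P0 \<omega>)) (borel \<Otimes>\<^sub>M borel))
      else sets (vimage_algebra (space P) (\<xi> k) (count_space (Pow J))))"

definition history :: "'w measure \<Rightarrow> nat set \<Rightarrow> ('w \<Rightarrow> real^'n) \<Rightarrow> ('w \<Rightarrow> real^'n)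
    \<Rightarrow> (nat \<Rightarrow> 'w \<Rightarrow> nat set) \<Rightarrow> nat \<Rightarrow> 'w measure" where
  "history P J X0 P0 \<xi> l = sigma (space P) (\<Union>k\<le>l. source_events P J X0 P0 \<xi> k)"

definition random_batches :: "'w measure \<Rightarrow> nat set \<Rightarrow> nat \<Rightarrow> nat
    \<Rightarrow> ('w \<Rightarrow> real^'n) \<Rightarrow> ('w \<Rightarrow> real^'n) \<Rightarrow> (nat \<Rightarrow> 'w \<Rightarrow> nat set) \<Rightarrow> bool" where
  "random_batches P J s L X0 P0 \<xi> \<longleftrightarrow>
     (\<forall>l\<in>{1..L}. \<xi> l \<in> measurable P (count_space (Pow J)) \<and>
        distr P (count_space (Pow J)) (\<xi> l) =
          uniform_measure (count_space (Pow J)) {S. S \<subseteq> J \<and> card S = s}) \<and>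
     prob_space.indep_sets P (source_events P J X0 P0 \<xi>) {0..L}"

definition adapted_batch :: "'w measure \<Rightarrow> nat set \<Rightarrow> ('w \<Rightarrow> real^'n) \<Rightarrow> ('w \<Rightarrow> real^'n)
    \<Rightarrow> (nat \<Rightarrow> 'w \<Rightarrow> nat set) \<Rightarrow> nat \<Rightarrow> real \<Rightarrow> (real \<Rightarrow> 'w \<Rightarrow> real^'n) \<Rightarrow> bool" where
  "adapted_batch P J X0 P0 \<xi> L \<Delta>t y \<longleftrightarrow>
     (\<forall>l\<in>{1..L}. \<forall>t\<in>{real (l - 1) * \<Delta>t..real l * \<Delta>t}.
        y t \<in> borel_measurable (history P J X0 P0 \<xi> l))"

end

theory Submission
  imports Defs
begin

text \<open>
  The full flow conserves \<open>H\<close>, so only the drift of \<open>H\<close> along the random batch flow matters. On one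
  batch interval the batch Hamiltonian is conserved, hence \<open>H\<close> changes exactly by the increment of
  \<open>D z = (1/s) \<Sum>\<^sub>S \<psi>\<^sub>j z - (1/N) \<Sum>\<^sub>J \<psi>\<^sub>j z\<close> along the path. To first order this increment is
  \<open>(\<Delta>t/m) \<nabla>D(x) \<bullet> p\<close> at the left end point, a martingale difference because a fresh batch is
  unbiased and independent of the past; the remainder is at most \<open>c \<Delta>t\<^sup>2 (1 + b\<^sup>2)\<close> with
  \<open>b = |P0| + 2MT\<close>, a bound for the momentum on all of \<open>[0,T]\<close>. Orthogonality of the martingale
  differences gives the strong bound. For the weak one, expand \<open>\<phi>\<close> to second order at \<open>H(X0, P0)\<close>: the
  martingale has mean zero against \<open>\<phi>' (H(X0, P0))\<close>, and the quadratic term is the strong bound.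
\<close>

subsection \<open>Calculus of gradients and Newton's equations\<close>

text \<open>Nor need the energies be integrable, because \<open>X0\<close> carries no moment
  assumption, so every estimate concerns a difference of energies. The state is frozen at the left
  end of an interval because inside the interval it already depends on the current batch. Rather
  than conditioning on the past, the proof writes the leading term as a finite sum of products of a
  past variable and a centred inclusion indicator, so that independence of real variables and the
  inclusion probability s/N suffice. The factor 1 + T^2 is the order of E[1 + b^2]. With Q = T (1 +
  T^2) \<Delta>t, the martingale has variance at most of order Q, whereas the squared remainder is
  of order Q^2, which calls for the fourth moment of \<open>P0\<close> and for Q \<le> 1.\<close>

lemma GDERIV_lipschitz_taylor:
  fixes f :: "'a::real_inner \<Rightarrow> real"
  assumes f: "\<And>z. GDERIV f z :> g z"
    and g: "\<And>y z. norm (g z - g y) \<le> K * norm (z - y)"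
  shows "\<bar>f z - f y - g y \<bullet> (z - y)\<bar> \<le> K * (norm (z - y))\<^sup>2"
proof -
  define v where "v = z - y"
  \<comment> \<open>\<open>q\<close> is \<open>f\<close> along the segment with its linear part at
    \<open>y\<close> removed, so \<open>q 1 - q 0\<close> is the Taylor remainder. Estimating the
    intermediate \<open>t\<close> by 1 yields \<open>K\<close> in place of the sharp K/2.\<close>
  define q where "q t = f (y + t *\<^sub>R v) - t * (g y \<bullet> v)" for t
  have K0: "K * norm v \<ge> 0"
    using g[of z y] norm_ge_zero[of "g z - g y"] unfolding v_def by linarith
  have "(q has_derivative (\<lambda>h. h * ((g (y + t *\<^sub>R v) - g y) \<bullet> v))) (at t)" for t
  proof -
    have "(f has_derivative (\<lambda>h. h \<bullet> g (y + t *\<^sub>R v))) (at (y + t *\<^sub>R v))"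
      using f unfolding gderiv_def .
    moreover have "((\<lambda>t. y + t *\<^sub>R v) has_derivative (\<lambda>h. h *\<^sub>R v)) (at t)"
      by (auto intro!: derivative_eq_intros)
    ultimately have "((\<lambda>t. f (y + t *\<^sub>R v)) has_derivative (\<lambda>h. (h *\<^sub>R v) \<bullet> g (y + t *\<^sub>R v))) (at t)"
      using diff_chain_at by (fastforce simp: o_def)
    then have "(q has_derivative (\<lambda>h. (h *\<^sub>R v) \<bullet> g (y + t *\<^sub>R v) - h * (g y \<bullet> v))) (at t)"
      unfolding q_def by (intro has_derivative_diff has_derivative_mult_left has_derivative_ident)
    then show ?thesis
      by (simp add: inner_diff_right right_diff_distrib inner_commute)
  qed
  then have "\<exists>t\<in>{0<..<1}. q 1 - q 0 = (1 - 0) * ((g (y + t *\<^sub>R v) - g y) \<bullet> v)"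
    using mvt_simple[of 0 1 q "\<lambda>t h. h * ((g (y + t *\<^sub>R v) - g y) \<bullet> v)"]
      has_derivative_at_withinI by fastforce
  then obtain t where t: "0 < t" "t < 1" "q 1 - q 0 = (g (y + t *\<^sub>R v) - g y) \<bullet> v"
    by auto
  have "q 1 - q 0 = f z - f y - g y \<bullet> (z - y)"
    by (simp add: q_def v_def)
  moreover have "\<bar>(g (y + t *\<^sub>R v) - g y) \<bullet> v\<bar> \<le> K * norm v * norm v"
  proof -
    have "norm (g (y + t *\<^sub>R v) - g y) \<le> t * (K * norm v)"
      using g[of "y + t *\<^sub>R v" y] t by (simp add: mult_ac)
    also have "\<dots> \<le> K * norm v"
      using t K0 by (simp add: mult_left_le_one_le)
    finally show ?thesis
      using Cauchy_Schwarz_ineq2[of "g (y + t *\<^sub>R v) - g y" v] mult_right_mono[OF _ norm_ge_zero[of v]]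
      by fastforce
  qed
  ultimately show ?thesis
    using t by (simp add: v_def power2_eq_square mult.assoc)
qed

text \<open>Riesz representation: the adjoint of the derivative, applied to 1, is a gradient vector,
  and uniqueness identifies it with the description that defines \<open>grad\<close>.\<close>

lemma GDERIV_grad:
  fixes f :: "'a::euclidean_space \<Rightarrow> real"
  assumes "f differentiable (at x)"
  shows "GDERIV f x :> grad f x"
proof -
  obtain f' where f': "(f has_derivative f') (at x)"
    using assms by (auto simp: differentiable_def)
  have "f' = (\<lambda>h. h \<bullet> adjoint f' 1)"
    using adjoint_works[OF has_derivative_linear[OF f'], of _ 1] by auto
  then have "GDERIV f x :> adjoint f' 1"
    using f' by (simp add: gderiv_def)
  then show ?thesis
    using grad_eqI by metis
qed

lemma grad_lipschitz:
  fixes f :: "real^'n \<Rightarrow> real"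
  assumes "C2_fun f" "\<And>y. onorm ((*v) (hess f y)) \<le> K"
  shows "norm (grad f z - grad f y) \<le> K * norm (z - y)"
proof (rule differentiable_bound[of UNIV "grad f" "\<lambda>x. (*v) (hess f x)"])
  show "(grad f has_derivative (*v) (hess f x)) (at x within UNIV)" for x
    using assms(1) jacobian_works[of "grad f" "at x"] by (auto simp: C2_fun_def hess_def)
qed (use assms in auto)

text \<open>The bound does not depend on the number of terms. Applied to a batch and to
  \<open>J\<close>, it is the source of the uniformity of all constants in the size of
  \<open>J\<close>.\<close>

lemma norm_mean_le:
  fixes v :: "'i \<Rightarrow> 'a::real_normed_vector"
  assumes "\<And>j. j \<in> S \<Longrightarrow> norm (v j) \<le> K" "card S > 0"
  shows "norm ((1 / real (card S)) *\<^sub>R (\<Sum>j\<in>S. v j)) \<le> K"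
proof -
  have "norm (\<Sum>j\<in>S. v j) \<le> real (card S) * K"
    using sum_norm_bound[of S v K] assms by auto
  then show ?thesis
    using assms(2) by (simp add: field_simps)
qed

lemma GDERIV_mean:
  fixes f :: "'i \<Rightarrow> 'a::euclidean_space \<Rightarrow> real"
  assumes "\<And>j. j \<in> S \<Longrightarrow> GDERIV (f j) z :> g j"
  shows "GDERIV (\<lambda>z. c * (\<Sum>j\<in>S. f j z)) z :> c *\<^sub>R (\<Sum>j\<in>S. g j)"
  using assms unfolding gderiv_def
  by (auto intro!: derivative_eq_intros simp: inner_sum_right)

lemma GDERIV_minus_fun:
  assumes "GDERIV f z :> a" "GDERIV g z :> b"
  shows "GDERIV (\<lambda>z. f z - g z) z :> a - b"
  using assms unfolding gderiv_def
  by (auto intro!: derivative_eq_intros simp: inner_diff_right)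

text \<open>The kinetic part changes at rate -p . F / m, which cancels the rate F . p / m of the
  potential. Derivatives are required only in the open interval, with continuity up to the ends,
  because the batch force jumps at grid points.\<close>

lemma newton_energy:
  fixes x p :: "real \<Rightarrow> 'a::real_inner"
  assumes "a < b" "m > 0" "continuous_on {a..b} x" "continuous_on {a..b} p"
    and x: "\<And>t. t \<in> {a<..<b} \<Longrightarrow> (x has_vector_derivative (1 / m) *\<^sub>R p t) (at t)"
    and p: "\<And>t. t \<in> {a<..<b} \<Longrightarrow> (p has_vector_derivative - F (x t)) (at t)"
    and U: "\<And>z. GDERIV U z :> F z"
  shows "(norm (p b))\<^sup>2 / (2 * m) + U (x b) = (norm (p a))\<^sup>2 / (2 * m) + U (x a)"
proof -
  have U': "(U has_derivative (\<lambda>h. h \<bullet> F z)) (at z)" for z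
    using U unfolding gderiv_def .
  have contU: "continuous_on UNIV U"
    by (meson U' continuous_at_imp_continuous_on has_derivative_continuous)
  define E where "E t = (p t \<bullet> p t) / (2 * m) + U (x t)" for t
  have "continuous_on {a..b} E"
    unfolding E_def
    by (intro continuous_intros assms continuous_on_compose2[OF contU]) (use \<open>m > 0\<close> in auto)
  moreover have "DERIV E t :> 0" if "a < t" "t < b" for t
  proof -
    have x': "(x has_derivative (\<lambda>h. h *\<^sub>R (1 / m) *\<^sub>R p t)) (at t)"
      and p': "(p has_derivative (\<lambda>h. h *\<^sub>R (- F (x t)))) (at t)"
      using x[of t] p[of t] that by (auto simp: has_vector_derivative_def)
    have "((\<lambda>t. U (x t)) has_derivative (\<lambda>h. (h *\<^sub>R (1 / m) *\<^sub>R p t) \<bullet> F (x t))) (at t)"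
      using diff_chain_at[OF x' U'] by (simp add: o_def)
    moreover have "((\<lambda>t. (p t \<bullet> p t) / (2 * m)) has_derivative
        (\<lambda>h. (p t \<bullet> (h *\<^sub>R (- F (x t))) + (h *\<^sub>R (- F (x t))) \<bullet> p t) / (2 * m))) (at t)"
      by (intro bounded_linear.has_derivative[OF bounded_linear_divide] has_derivative_inner p')
    ultimately have "(E has_derivative (\<lambda>h. (p t \<bullet> (h *\<^sub>R (- F (x t))) + (h *\<^sub>R (- F (x t))) \<bullet> p t) / (2 * m)
        + (h *\<^sub>R (1 / m) *\<^sub>R p t) \<bullet> F (x t))) (at t)"
      unfolding E_def by (rule has_derivative_add[rotated])
    also have "(\<lambda>h. (p t \<bullet> (h *\<^sub>R (- F (x t))) + (h *\<^sub>R (- F (x t))) \<bullet> p t) / (2 * m)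
        + (h *\<^sub>R (1 / m) *\<^sub>R p t) \<bullet> F (x t)) = (*) 0"
      using \<open>m > 0\<close> by (auto simp: fun_eq_iff inner_commute field_simps)
    finally show ?thesis
      unfolding has_field_derivative_def .
  qed
  ultimately have "E b = E a"
    using DERIV_isconst_end[of a b E] \<open>a < b\<close> by auto
  then show ?thesis
    by (simp add: E_def power2_norm_eq_inner)
qed

lemma norm_increment_le:
  fixes f :: "real \<Rightarrow> 'a::real_inner"
  assumes "a \<le> b" "continuous_on {a..b} f"
    and f: "\<And>t. t \<in> {a<..<b} \<Longrightarrow> (f has_vector_derivative f' t) (at t)"
    and K: "\<And>t. t \<in> {a<..<b} \<Longrightarrow> norm (f' t) \<le> K"
  shows "norm (f b - f a) \<le> K * (b - a)"
proof (cases "a = b")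
  case False
  then have "a < b" using assms by simp
  moreover have "(f has_derivative (\<lambda>h. h *\<^sub>R f' t)) (at t)" if "a < t" "t < b" for t
    using f that by (simp add: has_vector_derivative_def)
  ultimately obtain t where "t \<in> {a<..<b}" "norm (f b - f a) \<le> norm ((b - a) *\<^sub>R f' t)"
    using mvt_general[of a b f "\<lambda>t h. h *\<^sub>R f' t"] assms by auto
  moreover have "norm ((b - a) *\<^sub>R f' t) \<le> K * (b - a)" if "t \<in> {a<..<b}" for t
    using K[OF that] \<open>a < b\<close> by (simp add: mult.commute)
  ultimately show ?thesis using order_trans by blast
qed simp

text \<open>A bounded force changes the momentum at most linearly in time; integrating once more
  bounds the deviation of the position from free flight quadratically.\<close>

lemma newton_increments:
  fixes x p :: "real \<Rightarrow> 'a::real_inner"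
  assumes "a < b" "m > 0" and cx: "continuous_on {a..b} x" and cp: "continuous_on {a..b} p"
    and x: "\<And>t. t \<in> {a<..<b} \<Longrightarrow> (x has_vector_derivative (1 / m) *\<^sub>R p t) (at t)"
    and p: "\<And>t. t \<in> {a<..<b} \<Longrightarrow> (p has_vector_derivative f t) (at t)"
    and f: "\<And>t. norm (f t) \<le> K"
  shows "norm (p b - p a) \<le> K * (b - a)"
    and "norm (x b - x a - ((b - a) / m) *\<^sub>R p a) \<le> K * (b - a)\<^sup>2 / m"
proof -
  have p_inc: "norm (p t - p a) \<le> K * (t - a)" if "t \<in> {a..b}" for t
    using that continuous_on_subset[OF cp, of "{a..t}"] p f
    by (intro norm_increment_le[of a t p f K]) auto
  then show "norm (p b - p a) \<le> K * (b - a)"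
    using \<open>a < b\<close> by simp
  have "K \<ge> 0"
    using f[of a] norm_ge_zero[of "f a"] by linarith
  \<comment> \<open>Position minus free flight: its velocity is \<open>(p t - p a) / m\<close>,
    which \<open>p_inc\<close> controls.\<close>
  define y where "y t = x t - ((t - a) / m) *\<^sub>R p a" for t
  have "norm (y b - y a) \<le> (K * (b - a) / m) * (b - a)"
  proof (rule norm_increment_le)
    show "continuous_on {a..b} y"
      unfolding y_def using cx \<open>m > 0\<close> by (intro continuous_intros) auto
    show "(y has_vector_derivative (1 / m) *\<^sub>R (p t - p a)) (at t)" if "t \<in> {a<..<b}" for t
    proof -
      have "((\<lambda>t. ((t - a) / m) *\<^sub>R p a) has_vector_derivative (1 / m) *\<^sub>R p a) (at t)"
        by (auto intro!: derivative_eq_intros simp: has_vector_derivative_def divide_inverse)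
      from has_vector_derivative_diff[OF x[OF that] this] show ?thesis
        by (simp add: y_def[abs_def] scaleR_diff_right)
    qed
    show "norm ((1 / m) *\<^sub>R (p t - p a)) \<le> K * (b - a) / m" if "t \<in> {a<..<b}" for t
    proof -
      have "norm (p t - p a) \<le> K * (b - a)"
        using p_inc[of t] that mult_left_mono[OF _ \<open>K \<ge> 0\<close>, of "t - a" "b - a"] by auto
      then show ?thesis
        using \<open>m > 0\<close> by (simp add: divide_right_mono)
    qed
  qed (use \<open>a < b\<close> in auto)
  then show "norm (x b - x a - ((b - a) / m) *\<^sub>R p a) \<le> K * (b - a)\<^sup>2 / m"
    by (simp add: y_def power2_eq_square algebra_simps)
qed

subsection \<open>Energy along one batch interval\<close>

locale newton_potentials =
  fixes m M :: real and s :: nat and J :: "nat set"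
    and V :: "real^'n \<Rightarrow> real" and \<psi> :: "nat \<Rightarrow> real^'n \<Rightarrow> real"
  assumes m_pos: "m > 0" and s_pos: "s \<ge> 1"
    and finite_J: "finite J" and card_J: "card J \<ge> s"
    and V_C1: "C1_fun V" and V_bound: "\<And>y. norm (grad V y) \<le> M"
    and \<psi>_C2: "\<And>j. j \<in> J \<Longrightarrow> C2_fun (\<psi> j)"
    and \<psi>_bound: "\<And>j y. j \<in> J \<Longrightarrow> norm (grad (\<psi> j) y) \<le> M"
    and \<psi>_hess: "\<And>j y. j \<in> J \<Longrightarrow> onorm ((*v) (hess (\<psi> j) y)) \<le> M"
begin

text \<open>The function D of the overview for a fixed batch \<open>S\<close>: its gradient is the
  batch force minus the full force.\<close>

definition fluct :: "nat set \<Rightarrow> real^'n \<Rightarrow> real" where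
  "fluct S z = (1 / real s) * (\<Sum>j\<in>S. \<psi> j z) - (1 / real (card J)) * (\<Sum>j\<in>J. \<psi> j z)"

definition grad_fluct :: "nat set \<Rightarrow> real^'n \<Rightarrow> real^'n" where
  "grad_fluct S z = (1 / real s) *\<^sub>R (\<Sum>j\<in>S. grad (\<psi> j) z)
     - (1 / real (card J)) *\<^sub>R (\<Sum>j\<in>J. grad (\<psi> j) z)"

abbreviation energy :: "real^'n \<Rightarrow> real^'n \<Rightarrow> real" where
  "energy \<equiv> Ham m V J \<psi>"

lemma M_nonneg: "M \<ge> 0"
  using V_bound norm_ge_zero order_trans by blast

lemma card_J_pos: "card J > 0"
  using card_J s_pos by linarith

lemma GDERIV_V: "GDERIV V z :> grad V z"
  using V_C1 GDERIV_grad by (auto simp: C1_fun_def)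

lemma GDERIV_\<psi>: "j \<in> J \<Longrightarrow> GDERIV (\<psi> j) z :> grad (\<psi> j) z"
  using \<psi>_C2[of j] by (intro GDERIV_grad) (auto simp: C1_fun_def C2_fun_def)

lemma GDERIV_fluct:
  assumes "S \<subseteq> J"
  shows "GDERIV (fluct S) z :> grad_fluct S z"
  unfolding fluct_def grad_fluct_def using assms
  by (intro GDERIV_minus_fun GDERIV_mean GDERIV_\<psi>) auto

lemma norm_grad_fluct_le:
  assumes "S \<subseteq> J" "card S = s"
  shows "norm (grad_fluct S z) \<le> 2 * M"
proof -
  have "norm ((1 / real (card S)) *\<^sub>R (\<Sum>j\<in>S. grad (\<psi> j) z)) \<le> M"
    using assms \<psi>_bound s_pos by (intro norm_mean_le) auto
  moreover have "norm ((1 / real (card J)) *\<^sub>R (\<Sum>j\<in>J. grad (\<psi> j) z)) \<le> M"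
    using \<psi>_bound card_J_pos by (intro norm_mean_le) auto
  ultimately show ?thesis
    unfolding grad_fluct_def assms(2)
    using order_trans[OF norm_triangle_ineq4 add_mono] by fastforce
qed

lemma grad_fluct_lipschitz:
  assumes "S \<subseteq> J" "card S = s"
  shows "norm (grad_fluct S z - grad_fluct S y) \<le> 2 * M * norm (z - y)"
proof -
  have *: "norm ((1 / real (card A)) *\<^sub>R (\<Sum>j\<in>A. grad (\<psi> j) z - grad (\<psi> j) y)) \<le> M * norm (z - y)"
    if "A \<subseteq> J" "card A > 0" for A
    using that \<psi>_C2 \<psi>_hess by (intro norm_mean_le grad_lipschitz) auto
  have "grad_fluct S z - grad_fluct S y
      = (1 / real (card S)) *\<^sub>R (\<Sum>j\<in>S. grad (\<psi> j) z - grad (\<psi> j) y)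
        - (1 / real (card J)) *\<^sub>R (\<Sum>j\<in>J. grad (\<psi> j) z - grad (\<psi> j) y)"
    unfolding grad_fluct_def assms(2) sum_subtractf scaleR_diff_right by (simp add: algebra_simps)
  moreover have "norm \<dots> \<le> M * norm (z - y) + M * norm (z - y)"
    using *[of S] *[of J] assms s_pos card_J_pos
    by (intro order_trans[OF norm_triangle_ineq4 add_mono]) auto
  ultimately show ?thesis by simp
qed

text \<open>Valid for every \<open>S\<close>: the first two terms form the energy that is conserved
  while the batch \<open>S\<close> acts, so only \<open>fluct S\<close> can change.\<close>

lemma energy_eq_batch_energy:
  "energy z p = (norm p)\<^sup>2 / (2 * m) + (V z - (1 / real s) * (\<Sum>j\<in>S. \<psi> j z)) + fluct S z"
  by (simp add: Ham_def fluct_def)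

lemma full_solution_energy:
  assumes "full_solution m V J \<psi> T x p" "T > 0"
  shows "energy (x T) (p T) = energy (x 0) (p 0)"
proof -
  define F where "F z = grad V z - (1 / real (card J)) *\<^sub>R (\<Sum>j\<in>J. grad (\<psi> j) z)" for z
  have sol: "(x has_vector_derivative (1 / m) *\<^sub>R p t) (at t within {0..T})"
    "(p has_vector_derivative - F (x t)) (at t within {0..T})" if "t \<in> {0..T}" for t
    using assms(1) that by (auto simp: full_solution_def F_def)
  have "(norm (p T))\<^sup>2 / (2 * m) + (V (x T) - (1 / real (card J)) * (\<Sum>j\<in>J. \<psi> j (x T)))
      = (norm (p 0))\<^sup>2 / (2 * m) + (V (x 0) - (1 / real (card J)) * (\<Sum>j\<in>J. \<psi> j (x 0)))"
  proof (rule newton_energy[where F = F and U = "\<lambda>z. V z - (1 / real (card J)) * (\<Sum>j\<in>J. \<psi> j z)"])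
    show "continuous_on {0..T} x" "continuous_on {0..T} p"
      using sol has_vector_derivative_continuous continuous_on_eq_continuous_within by blast+
    show "GDERIV (\<lambda>z. V z - (1 / real (card J)) * (\<Sum>j\<in>J. \<psi> j z)) z :> F z" for z
      unfolding F_def by (intro GDERIV_minus_fun GDERIV_mean GDERIV_V GDERIV_\<psi>)
    show "(x has_vector_derivative (1 / m) *\<^sub>R p t) (at t)"
      "(p has_vector_derivative - F (x t)) (at t)" if "t \<in> {0<..<T}" for t
      using sol[of t] that by (auto simp: at_within_Icc_at)
  qed (use assms m_pos in auto)
  then show ?thesis
    by (simp add: Ham_def)
qed

text \<open>The energy increment equals that of \<open>fluct S\<close>. Taylor expansion costs
  \<open>2 * M\<close> times the squared displacement, giving \<open>2 * M / m\<^sup>2\<close>;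
  replacing the displacement by free flight costs \<open>2 * M\<close> times
  \<open>2 * M * (b - a)\<^sup>2 / m\<close>, giving \<open>4 * M\<^sup>2 / m\<close>. The parameter
  \<open>B\<close> is left free so that one bound can serve all intervals.\<close>

lemma batch_step:
  assumes "a < b" "S \<subseteq> J" "card S = s" "continuous_on {a..b} x" "continuous_on {a..b} p"
    and x: "\<And>t. t \<in> {a<..<b} \<Longrightarrow> (x has_vector_derivative (1 / m) *\<^sub>R p t) (at t)"
    and p: "\<And>t. t \<in> {a<..<b} \<Longrightarrow> (p has_vector_derivative
      - grad V (x t) + (1 / real s) *\<^sub>R (\<Sum>j\<in>S. grad (\<psi> j) (x t))) (at t)"
    and B: "norm (p a) + 2 * M * (b - a) \<le> B"
  shows "norm (p b) \<le> norm (p a) + 2 * M * (b - a)"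
    and "\<bar>energy (x b) (p b) - energy (x a) (p a) - (b - a) / m * (grad_fluct S (x a) \<bullet> p a)\<bar>
      \<le> (2 * M / m\<^sup>2 + 4 * M\<^sup>2 / m) * (b - a)\<^sup>2 * (1 + B\<^sup>2)"
proof -
  define F where "F z = grad V z - (1 / real s) *\<^sub>R (\<Sum>j\<in>S. grad (\<psi> j) z)" for z
  define h where "h = b - a"
  have h: "h > 0" using \<open>a < b\<close> by (simp add: h_def)
  have p': "(p has_vector_derivative - F (x t)) (at t)" if "t \<in> {a<..<b}" for t
    using p[OF that] by (simp add: F_def)
  have F_le: "norm (- F z) \<le> 2 * M" for z
  proof -
    have "norm ((1 / real (card S)) *\<^sub>R (\<Sum>j\<in>S. grad (\<psi> j) z)) \<le> M"
      using assms \<psi>_bound s_pos by (intro norm_mean_le) auto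
    from order_trans[OF norm_triangle_ineq4 add_mono[OF V_bound[of z] this]] show ?thesis
      unfolding F_def assms(3) norm_minus_cancel by simp
  qed
  have inc: "norm (p b - p a) \<le> 2 * M * h" "norm (x b - x a - (h / m) *\<^sub>R p a) \<le> 2 * M * h\<^sup>2 / m"
    unfolding h_def
    by (rule newton_increments[where f = "\<lambda>t. - F (x t)" and K = "2 * M"]; (fact | rule m_pos))+
  show "norm (p b) \<le> norm (p a) + 2 * M * (b - a)"
    using inc(1) norm_triangle_sub[of "p b" "p a"] unfolding h_def by linarith
  define dE where "dE = energy (x b) (p b) - energy (x a) (p a)"
  have dE: "dE = fluct S (x b) - fluct S (x a)"
  proof -
    have "(norm (p b))\<^sup>2 / (2 * m) + (V (x b) - (1 / real s) * (\<Sum>j\<in>S. \<psi> j (x b)))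
        = (norm (p a))\<^sup>2 / (2 * m) + (V (x a) - (1 / real s) * (\<Sum>j\<in>S. \<psi> j (x a)))"
    proof (rule newton_energy[where F = F and U = "\<lambda>z. V z - (1 / real s) * (\<Sum>j\<in>S. \<psi> j z)"])
      show "GDERIV (\<lambda>z. V z - (1 / real s) * (\<Sum>j\<in>S. \<psi> j z)) z :> F z" for z
        unfolding F_def using assms by (intro GDERIV_minus_fun GDERIV_mean GDERIV_V GDERIV_\<psi>) auto
    qed (fact | rule m_pos)+
    then show ?thesis
      unfolding dE_def energy_eq_batch_energy[of _ _ S] by simp
  qed
  have "\<bar>dE - grad_fluct S (x a) \<bullet> (x b - x a)\<bar> \<le> 2 * M * (norm (x b - x a))\<^sup>2"
    unfolding dE using assms
    by (intro GDERIV_lipschitz_taylor GDERIV_fluct grad_fluct_lipschitz)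
  moreover have "(norm (x b - x a))\<^sup>2 \<le> h\<^sup>2 * B\<^sup>2 / m\<^sup>2"
  proof -
    have "norm (x b - x a) \<le> norm ((h / m) *\<^sub>R p a) + norm (x b - x a - (h / m) *\<^sub>R p a)"
      by (rule norm_triangle_sub)
    also have "\<dots> \<le> (h / m) * norm (p a) + 2 * M * h\<^sup>2 / m"
      using inc(2) h m_pos by simp
    \<comment> \<open>Factoring out \<open>h / m\<close> leaves the upper bound for the momentum on
      the interval, which is what \<open>B\<close> dominates.\<close>
    also have "\<dots> = (h / m) * (norm (p a) + 2 * M * h)"
      by (simp add: algebra_simps power2_eq_square add_divide_distrib)
    also have "\<dots> \<le> (h / m) * B"
      using B h m_pos by (intro mult_left_mono) (auto simp: h_def)
    finally show ?thesis
      using power_mono[of "norm (x b - x a)" "h / m * B" 2] by (simp add: power_mult_distrib power_divide)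
  qed
  then have "2 * M * (norm (x b - x a))\<^sup>2 \<le> 2 * M * (h\<^sup>2 * B\<^sup>2 / m\<^sup>2)"
    using M_nonneg by (intro mult_left_mono) auto
  moreover have "\<bar>grad_fluct S (x a) \<bullet> (x b - x a - (h / m) *\<^sub>R p a)\<bar> \<le> 2 * M * (2 * M * h\<^sup>2 / m)"
  proof -
    have "norm (grad_fluct S (x a)) * norm (x b - x a - (h / m) *\<^sub>R p a) \<le> 2 * M * (2 * M * h\<^sup>2 / m)"
      using M_nonneg by (intro mult_mono norm_grad_fluct_le inc(2)) (auto simp: assms)
    then show ?thesis
      using Cauchy_Schwarz_ineq2 order_trans by blast
  qed
  ultimately have "\<bar>dE - h / m * (grad_fluct S (x a) \<bullet> p a)\<bar>
      \<le> 2 * M * (h\<^sup>2 * B\<^sup>2 / m\<^sup>2) + 2 * M * (2 * M * h\<^sup>2 / m)"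
    by (simp add: inner_diff_right)
  also have "\<dots> = 2 * M / m\<^sup>2 * h\<^sup>2 * B\<^sup>2 + 4 * M\<^sup>2 / m * h\<^sup>2 * 1"
    by (simp add: power2_eq_square)
  also have "\<dots> \<le> 2 * M / m\<^sup>2 * h\<^sup>2 * (1 + B\<^sup>2) + 4 * M\<^sup>2 / m * h\<^sup>2 * (1 + B\<^sup>2)"
    using M_nonneg m_pos by (intro add_mono mult_left_mono) auto
  finally show "\<bar>energy (x b) (p b) - energy (x a) (p a) - (b - a) / m * (grad_fluct S (x a) \<bullet> p a)\<bar>
      \<le> (2 * M / m\<^sup>2 + 4 * M\<^sup>2 / m) * (b - a)\<^sup>2 * (1 + B\<^sup>2)"
    by (simp add: dE_def h_def algebra_simps)
qed

text \<open>Batch and state are separated: \<open>S\<close> enters only through scalar coefficients,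
  which become random weights of mean zero. The subtracted s/N arises from 1/N = (1/s)
  (s/N).\<close>

lemma grad_fluct_eq_weighted_sum:
  assumes "S \<subseteq> J"
  shows "grad_fluct S z = (1 / real s) *\<^sub>R
    (\<Sum>j\<in>J. ((if j \<in> S then 1 else 0) - real s / real (card J)) *\<^sub>R grad (\<psi> j) z)"
proof -
  have "(\<Sum>j\<in>J. (if j \<in> S then 1 else 0 :: real) *\<^sub>R grad (\<psi> j) z)
      = (\<Sum>j\<in>J. if j \<in> S then grad (\<psi> j) z else 0)"
    by (intro sum.cong) auto
  also have "\<dots> = (\<Sum>j\<in>S. grad (\<psi> j) z)"
    using assms finite_J by (simp add: sum.If_cases Int_absorb1)
  finally show ?thesis
    using s_pos
    by (simp add: grad_fluct_def scaleR_diff_left sum_subtractf scaleR_diff_right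
        flip: scaleR_sum_right)
qed

lemma energy_measurable:
  assumes "f \<in> borel_measurable N" "g \<in> borel_measurable N"
  shows "(\<lambda>\<omega>. energy (f \<omega>) (g \<omega>)) \<in> borel_measurable N"
proof -
  have "V \<in> borel_measurable borel" "\<And>j. j \<in> J \<Longrightarrow> \<psi> j \<in> borel_measurable borel"
    using V_C1 \<psi>_C2
    by (auto simp: C2_fun_def C1_fun_def continuous_on_eq_continuous_at
        intro!: borel_measurable_continuous_onI differentiable_imp_continuous_within)
  then have "(\<lambda>\<omega>. V (f \<omega>)) \<in> borel_measurable N"
    "\<And>j. j \<in> J \<Longrightarrow> (\<lambda>\<omega>. \<psi> j (f \<omega>)) \<in> borel_measurable N"
    using measurable_compose[OF assms(1)] by auto
  then show ?thesis
    unfolding Ham_def using measurable_compose[OF assms(2) borel_measurable_norm]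
    by (intro borel_measurable_diff borel_measurable_add borel_measurable_divide
        borel_measurable_times borel_measurable_sum borel_measurable_const
        borel_measurable_power)
qed

lemma grad_\<psi>_measurable: "j \<in> J \<Longrightarrow> grad (\<psi> j) \<in> borel_measurable borel"
  using \<psi>_C2 by (auto simp: C2_fun_def C1_fun_def intro: borel_measurable_continuous_onI)

end

subsection \<open>Random batches and their independence of the past\<close>

lemma measurable_finer_algebra:
  assumes "sets A \<subseteq> sets B" "space A = space B" "f \<in> measurable A N"
  shows "f \<in> measurable B N"
  using measurable_mono[of N N A B] assms by auto

lemma sets_vimage_algebra_subset_Pow: "sets (vimage_algebra X f N) \<subseteq> Pow X"
  using sets.space_closed[of "vimage_algebra X f N"] by simp

section \<open>Inclusion probability of an index under uniform sampling\<close>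

lemma card_subsets_containing:
  assumes "finite J" "j \<in> J" "s \<ge> 1"
  shows "card {S. S \<subseteq> J \<and> card S = s \<and> j \<in> S} = (card J - 1) choose (s - 1)"
proof -
  have "bij_betw (insert j) {S. S \<subseteq> J - {j} \<and> card S = s - 1} {S. S \<subseteq> J \<and> card S = s \<and> j \<in> S}"
  proof (rule bij_betwI[where g = "\<lambda>S. S - {j}"])
    show "insert j \<in> {S. S \<subseteq> J - {j} \<and> card S = s - 1} \<rightarrow> {S. S \<subseteq> J \<and> card S = s \<and> j \<in> S}"
    proof (safe, goal_cases)
      case (3 S)
      then have "finite S" "j \<notin> S" using assms(1) finite_subset[of S "J - {j}"] by auto
      then show ?case using 3 assms by simp
    qed (use assms in auto)
    show "(\<lambda>S. S - {j}) \<in> {S. S \<subseteq> J \<and> card S = s \<and> j \<in> S} \<rightarrow> {S. S \<subseteq> J - {j} \<and> card S = s - 1}"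
      by (auto simp: card_Diff_singleton)
  qed auto
  then have "card {S. S \<subseteq> J \<and> card S = s \<and> j \<in> S} = card {S. S \<subseteq> J - {j} \<and> card S = s - 1}"
    by (simp add: bij_betw_same_card)
  then show ?thesis
    using assms by (simp add: n_subsets)
qed

text \<open>The quotient of the binomials (N-1 over s-1) and (N over s) is s/N by the absorption
  identity; this is what makes the batch mean unbiased. The hypothesis \<open>s \<le> card J\<close>
  keeps the conditioning set nonempty.\<close>

lemma uniform_subset_inclusion:
  assumes "finite J" "j \<in> J" "s \<ge> 1" "s \<le> card J"
  shows "measure (uniform_measure (count_space (Pow J)) {S. S \<subseteq> J \<and> card S = s})
    {S. S \<subseteq> J \<and> j \<in> S} = real s / real (card J)"
proof -
  let ?A = "{S. S \<subseteq> J \<and> card S = s}"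
  have fin: "finite (Pow J)" using assms by simp
  have cA: "card ?A = card J choose s" "card J choose s > 0"
    using assms by (auto simp: n_subsets zero_less_binomial)
  have finA: "finite ?A" using cA card_gt_0_iff by metis
  have e: "emeasure (count_space (Pow J)) ?A = of_nat (card J choose s)"
    using finA cA by (subst emeasure_count_space_finite) auto
  have m: "measure (count_space (Pow J)) B = real (card B)" if "B \<subseteq> Pow J" for B
    using that finite_subset[OF that fin]
    by (simp add: measure_def emeasure_count_space_finite)
  have "measure (uniform_measure (count_space (Pow J)) ?A) {S. S \<subseteq> J \<and> j \<in> S}
      = measure (count_space (Pow J)) (?A \<inter> {S. S \<subseteq> J \<and> j \<in> S}) / measure (count_space (Pow J)) ?A"
    using e cA by (intro measure_uniform_measure) auto
  also have "?A \<inter> {S. S \<subseteq> J \<and> j \<in> S} = {S. S \<subseteq> J \<and> card S = s \<and> j \<in> S}"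
    by auto
  also have "measure (count_space (Pow J)) \<dots> / measure (count_space (Pow J)) ?A
      = real ((card J - 1) choose (s - 1)) / real (card J choose s)"
    using assms cA by (subst (1 2) m) (auto simp: card_subsets_containing)
  also have "\<dots> = real s / real (card J)"
  proof -
    have "real s * real (card J choose s) = real (card J) * real ((card J - 1) choose (s - 1))"
      using times_binomial_minus1_eq[of s "card J"] assms by (simp flip: of_nat_mult)
    moreover have "real (card J choose s) > 0" "real (card J) > 0"
      using cA assms by linarith+
    ultimately show ?thesis
      by (simp add: frac_eq_eq mult.commute)
  qed
  finally show ?thesis .
qed

text \<open>Only the batch flow appears; the full flow will enter through its initial energy alone.
  \<open>P0_int\<close> accompanies \<open>P0_moment\<close> because a non-integrable function has
  integral 0, so that the moment bound by itself would be vacuous for it.\<close>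

locale random_batch = newton_potentials m M s J V \<psi> + prob_space P
  for m M :: real and s :: nat and J :: "nat set"
    and V :: "real^'n \<Rightarrow> real" and \<psi> :: "nat \<Rightarrow> real^'n \<Rightarrow> real" and P :: "'w measure" +
  fixes L :: nat and \<Delta>t :: real and X0 P0 :: "'w \<Rightarrow> real^'n"
    and \<xi> :: "nat \<Rightarrow> 'w \<Rightarrow> nat set" and xb pb :: "real \<Rightarrow> 'w \<Rightarrow> real^'n"
  assumes L_pos: "L \<ge> 1" and \<Delta>t_pos: "\<Delta>t > 0"
    and X0: "X0 \<in> borel_measurable P" and P0: "P0 \<in> borel_measurable P"
    and P0_int: "integrable P (\<lambda>\<omega>. norm (P0 \<omega>) ^ 4)"
    and P0_moment: "(\<integral>\<omega>. norm (P0 \<omega>) ^ 4 \<partial>P) \<le> M"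
    and batches: "random_batches P J s L X0 P0 \<xi>"
    and xb_adapted: "adapted_batch P J X0 P0 \<xi> L \<Delta>t xb"
    and pb_adapted: "adapted_batch P J X0 P0 \<xi> L \<Delta>t pb"
    and batch_sol: "AE \<omega> in P. batch_solution m V \<psi> s L \<Delta>t (\<lambda>l. \<xi> l \<omega>) (\<lambda>t. xb t \<omega>) (\<lambda>t. pb t \<omega>)
        \<and> xb 0 \<omega> = X0 \<omega> \<and> pb 0 \<omega> = P0 \<omega>"
begin

definition T where "T = real L * \<Delta>t"

abbreviation src where "src \<equiv> source_events P J X0 P0 \<xi>"
abbreviation hist where "hist \<equiv> history P J X0 P0 \<xi>"

text \<open>The grid values start from \<open>(X0, P0)\<close> itself: \<open>xb 0\<close> agrees with \<open>X0\<close> only almost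
  surely and is measurable only with respect to \<open>hist 1\<close>, not \<open>hist 0\<close>.\<close>

definition gx where "gx k \<omega> = (if k = 0 then X0 \<omega> else xb (real k * \<Delta>t) \<omega>)"
definition gp where "gp k \<omega> = (if k = 0 then P0 \<omega> else pb (real k * \<Delta>t) \<omega>)"

text \<open>The inclusion indicator minus its mean. Index shift: \<open>weight k\<close> belongs to
  batch \<open>Suc k\<close>, which acts between the grid points k and k + 1.\<close>

definition weight :: "nat \<Rightarrow> nat \<Rightarrow> 'w \<Rightarrow> real" where
  "weight k j \<omega> = (if j \<in> \<xi> (Suc k) \<omega> then 1 else 0) - real s / real (card J)"

text \<open>The inner product of the gradient of D with the momentum, frozen at grid point
  \<open>k\<close>. Written through weights it has no set-valued random index, so measurability and
  independence reduce to real variables.\<close>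

definition noise :: "nat \<Rightarrow> 'w \<Rightarrow> real" where
  "noise k \<omega> = (1 / real s) * (\<Sum>j\<in>J. weight k j \<omega> * (grad (\<psi> j) (gx k \<omega>) \<bullet> gp k \<omega>))"

definition mart :: "nat \<Rightarrow> 'w \<Rightarrow> real" where
  "mart k \<omega> = (\<Sum>i<k. \<Delta>t / m * noise i \<omega>)"

definition bd :: "'w \<Rightarrow> real" where
  "bd \<omega> = norm (P0 \<omega>) + 2 * M * T"

section \<open>The filtration of the initial data and the batches\<close>

lemma T_pos: "T > 0"
  using L_pos \<Delta>t_pos by (simp add: T_def)

lemma src_indep: "indep_sets src {0..L}"
  using batches by (simp add: random_batches_def)

lemma src_events: "k \<le> L \<Longrightarrow> src k \<subseteq> events"
  using src_indep by (auto simp: indep_sets_def)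

lemma src_Pow: "src k \<subseteq> Pow (space P)"
  by (simp add: source_events_def sets_vimage_algebra_subset_Pow)

lemma Int_stable_src: "Int_stable (src k)"
  by (auto simp: source_events_def sets.Int_stable)

lemma sets_hist: "sets (hist k) = sigma_sets (space P) (\<Union>i\<le>k. src i)"
  unfolding history_def using src_Pow by (intro sets_measure_of) blast

lemma space_hist [simp]: "space (hist k) = space P"
  unfolding history_def using src_Pow by (intro space_measure_of) blast

lemma sets_hist_subset: "k \<le> L \<Longrightarrow> sets (hist k) \<subseteq> events"
  unfolding sets_hist by (intro sets.sigma_sets_subset UN_least src_events) simp

lemma measurable_hist_P: "k \<le> L \<Longrightarrow> f \<in> measurable (hist k) N \<Longrightarrow> f \<in> measurable P N"
  using sets_hist_subset by (intro measurable_finer_algebra[of "hist k" P]) auto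

lemma measurable_hist_mono:
  assumes "k \<le> l" "f \<in> measurable (hist k) N"
  shows "f \<in> measurable (hist l) N"
proof -
  have "sets (hist k) \<subseteq> sets (hist l)"
    unfolding sets_hist using assms(1) by (intro sigma_sets_mono' UN_mono) auto
  then show ?thesis
    using assms(2) by (intro measurable_finer_algebra[of "hist k" "hist l"]) auto
qed

lemma \<xi>_measurable: "k < L \<Longrightarrow> \<xi> (Suc k) \<in> measurable P (count_space (Pow J))"
  and \<xi>_distr: "k < L \<Longrightarrow> distr P (count_space (Pow J)) (\<xi> (Suc k)) =
          uniform_measure (count_space (Pow J)) {S. S \<subseteq> J \<and> card S = s}"
  using batches by (auto simp: random_batches_def)

lemma \<xi>_subset: "k < L \<Longrightarrow> \<omega> \<in> space P \<Longrightarrow> \<xi> (Suc k) \<omega> \<subseteq> J"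
  using measurable_space[OF \<xi>_measurable] by auto

text \<open>The size of a batch is prescribed by its law and so holds almost surely, whereas
  \<open>\<xi>_subset\<close> holds at every sample point, from the codomain.\<close>

lemma AE_card_\<xi>: "AE \<omega> in P. \<forall>k<L. card (\<xi> (Suc k) \<omega>) = s"
proof (subst AE_all_countable, intro allI)
  show "AE \<omega> in P. k < L \<longrightarrow> card (\<xi> (Suc k) \<omega>) = s" for k
  proof (cases "k < L")
    case True
    have "AE S in distr P (count_space (Pow J)) (\<xi> (Suc k)). card S = s"
      unfolding \<xi>_distr[OF True] by (intro AE_uniform_measureI) auto
    from AE_distrD[OF \<xi>_measurable[OF True] this] show ?thesis by auto
  qed simp
qed

lemma member_\<xi>_src: "{\<omega> \<in> space P. j \<in> \<xi> (Suc k) \<omega>} \<in> src (Suc k)" if "k < L"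
proof -
  have "{\<omega> \<in> space P. j \<in> \<xi> (Suc k) \<omega>} = \<xi> (Suc k) -` {S. S \<subseteq> J \<and> j \<in> S} \<inter> space P"
    using \<xi>_subset[OF that] by auto
  also have "\<dots> \<in> sets (vimage_algebra (space P) (\<xi> (Suc k)) (count_space (Pow J)))"
    by (intro in_vimage_algebra) auto
  finally show ?thesis by (simp add: source_events_def)
qed

abbreviation batch_algebra where "batch_algebra k \<equiv> sigma (space P) (src (Suc k))"

lemma sets_batch_algebra: "sets (batch_algebra k) = sigma_sets (space P) (src (Suc k))"
  using src_Pow by (rule sets_measure_of)

lemma space_batch_algebra: "space (batch_algebra k) = space P"
  using src_Pow by (rule space_measure_of)

lemma weight_measurable:
  assumes "k < L"
  shows "weight k j \<in> borel_measurable (batch_algebra k)"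
proof -
  have "{\<omega> \<in> space (batch_algebra k). j \<in> \<xi> (Suc k) \<omega>} \<in> sets (batch_algebra k)"
    unfolding sets_batch_algebra space_batch_algebra
    using member_\<xi>_src[OF assms] by (rule sigma_sets.Basic)
  then show ?thesis
    unfolding weight_def[abs_def]
    by (intro borel_measurable_diff measurable_If borel_measurable_const) auto
qed

lemma weight_measurable_hist:
  assumes "k < L"
  shows "weight k j \<in> borel_measurable (hist (Suc k))"
proof (rule measurable_finer_algebra[OF _ _ weight_measurable[OF assms]])
  show "sets (batch_algebra k) \<subseteq> sets (hist (Suc k))"
    unfolding sets_batch_algebra sets_hist by (intro sigma_sets_mono') auto
qed (simp add: space_batch_algebra)

lemma weight_bounded: "\<bar>weight k j \<omega>\<bar> \<le> 1"
proof -
  have "0 \<le> real s / real (card J)" "real s / real (card J) \<le> 1"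
    using card_J s_pos by auto
  then show ?thesis by (auto simp: weight_def)
qed

lemma weight_integrable: "k < L \<Longrightarrow> integrable P (weight k j)"
  using measurable_hist_P[OF _ weight_measurable_hist] weight_bounded
  by (intro integrable_const_bound[of _ 1]) auto

text \<open>The inclusion event has probability s/N, the constant subtracted in
  \<open>weight\<close>.\<close>

lemma weight_mean_zero:
  assumes "k < L" "j \<in> J"
  shows "(\<integral>\<omega>. weight k j \<omega> \<partial>P) = 0"
proof -
  have ev: "{\<omega> \<in> space P. j \<in> \<xi> (Suc k) \<omega>} \<in> events"
    using member_\<xi>_src[OF assms(1)] src_events[of "Suc k"] assms by auto
  have "measure (distr P (count_space (Pow J)) (\<xi> (Suc k))) {S. S \<subseteq> J \<and> j \<in> S}
      = prob (\<xi> (Suc k) -` {S. S \<subseteq> J \<and> j \<in> S} \<inter> space P)"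
    using \<xi>_measurable[OF assms(1)] by (intro measure_distr) auto
  also have "\<xi> (Suc k) -` {S. S \<subseteq> J \<and> j \<in> S} \<inter> space P = {\<omega> \<in> space P. j \<in> \<xi> (Suc k) \<omega>}"
    using \<xi>_subset[OF assms(1)] by auto
  finally have pr: "prob {\<omega> \<in> space P. j \<in> \<xi> (Suc k) \<omega>} = real s / real (card J)"
    using uniform_subset_inclusion[OF finite_J assms(2) s_pos card_J]
    by (simp add: \<xi>_distr[OF assms(1)])
  have "(\<integral>\<omega>. weight k j \<omega> \<partial>P)
      = (\<integral>\<omega>. indicator {\<omega> \<in> space P. j \<in> \<xi> (Suc k) \<omega>} \<omega> - real s / real (card J) \<partial>P)"
    by (intro Bochner_Integration.integral_cong) (auto simp: weight_def)
  also have "\<dots> = 0"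
    using ev pr by (subst Bochner_Integration.integral_diff) (auto simp: prob_space emeasure_eq_measure)
  finally show ?thesis .
qed

text \<open>The past and the next batch are generated by disjoint blocks of an independent family
  with intersection-stable members, so the block sigma-algebras are independent.\<close>

lemma hist_indep: "k < L \<Longrightarrow> indep_set (sets (hist k)) (sigma_sets (space P) (src (Suc k)))"
proof -
  assume k: "k < L"
  \<comment> \<open>\<open>indep_set\<close> is \<open>indep_sets\<close> over the truth values,
    hence the Boolean index of the two blocks.\<close>
  define I where "I b = (if b then {..k} else {Suc k})" for b
  have "indep_sets (\<lambda>b. sigma_sets (space P) (\<Union>i\<in>I b. src i)) UNIV"
  proof (rule indep_sets_collect_sigma)
    show "indep_sets src (\<Union>b\<in>UNIV. I b)"
      using k by (intro indep_sets_mono_index[OF _ src_indep]) (auto simp: I_def UNIV_bool)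
    show "disjoint_family_on I UNIV"
      by (auto simp: disjoint_family_on_def I_def)
  qed (rule Int_stable_src)
  then show ?thesis
    unfolding indep_set_def
    by (rule indep_sets_mono_sets) (auto simp: I_def sets_hist split: bool.split)
qed

text \<open>The expectation of a product of independent integrable variables factorises, and the
  weight has mean zero. This integrated form replaces a conditional expectation given
  \<open>hist k\<close>.\<close>

lemma integral_weight_mult:
  assumes k: "k < L" and j: "j \<in> J" and f: "f \<in> borel_measurable (hist k)" "integrable P f"
  shows "integrable P (\<lambda>\<omega>. f \<omega> * weight k j \<omega>)" "(\<integral>\<omega>. f \<omega> * weight k j \<omega> \<partial>P) = 0"
proof -
  have "indep_var borel f borel (weight k j)"
    unfolding indep_var_eq
  proof (intro conjI)
    show "random_variable borel f" "random_variable borel (weight k j)"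
      using f k weight_integrable by auto
    have gen: "sigma_sets (space P) {g -` A \<inter> space P |A. A \<in> sets borel} \<subseteq> sets N"
      if "g \<in> borel_measurable N" "space N = space P" for g :: "'w \<Rightarrow> real" and N :: "'w measure"
      unfolding that(2)[symmetric]
      by (rule sets.sigma_sets_subset) (use measurable_sets[OF that(1)] in auto)
    note 1 = gen[OF f(1) space_hist]
    note 2 = gen[OF weight_measurable[OF k, of j] space_batch_algebra, unfolded sets_batch_algebra]
    show "indep_set (sigma_sets (space P) {f -` A \<inter> space P |A. A \<in> sets borel})
        (sigma_sets (space P) {weight k j -` A \<inter> space P |A. A \<in> sets borel})"
      using hist_indep[OF k] 1 2 unfolding indep_sets2_eq by blast
  qed
  note indep_var_integrable[OF this f(2) weight_integrable[OF k]]
    indep_var_lebesgue_integral[OF this f(2) weight_integrable[OF k]]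
  then show "integrable P (\<lambda>\<omega>. f \<omega> * weight k j \<omega>)" "(\<integral>\<omega>. f \<omega> * weight k j \<omega> \<partial>P) = 0"
    using weight_mean_zero[OF k j] by auto
qed

lemma initial_measurable:
  "X0 \<in> borel_measurable (hist k)" "P0 \<in> borel_measurable (hist k)"
proof -
  let ?W = "vimage_algebra (space P) (\<lambda>\<omega>. (X0 \<omega>, P0 \<omega>)) (borel \<Otimes>\<^sub>M borel)"
  have "(\<lambda>\<omega>. (X0 \<omega>, P0 \<omega>)) \<in> measurable ?W (borel \<Otimes>\<^sub>M borel)"
    by (intro measurable_vimage_algebra1) (auto simp: space_pair_measure)
  then have "X0 \<in> borel_measurable ?W" "P0 \<in> borel_measurable ?W"
    using measurable_compose[OF _ measurable_fst] measurable_compose[OF _ measurable_snd] by force+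
  moreover have "sets ?W \<subseteq> sets (hist 0)"
    unfolding sets_hist by (auto simp: source_events_def)
  ultimately have "X0 \<in> borel_measurable (hist 0)" "P0 \<in> borel_measurable (hist 0)"
    using measurable_finer_algebra[of ?W "hist 0"] by auto
  then show "X0 \<in> borel_measurable (hist k)" "P0 \<in> borel_measurable (hist k)"
    using measurable_hist_mono[of 0 k] by auto
qed

lemma grid_measurable:
  assumes "k \<le> L"
  shows "gx k \<in> borel_measurable (hist k)" "gp k \<in> borel_measurable (hist k)"
proof -
  \<comment> \<open>The grid time is read as the right end of interval \<open>k\<close>. Read as the
    left end of interval \<open>Suc k\<close> it would be measurable only for
    \<open>hist (Suc k)\<close>, which already contains the next batch.\<close>
  have *: "y (real k * \<Delta>t) \<in> borel_measurable (hist k)"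
    if "adapted_batch P J X0 P0 \<xi> L \<Delta>t y" "k \<noteq> 0" for y
    using that assms \<Delta>t_pos by (auto simp: adapted_batch_def intro: mult_right_mono)
  show "gx k \<in> borel_measurable (hist k)"
    using *[OF xb_adapted] initial_measurable(1)[of k] by (cases "k = 0") (auto simp: gx_def[abs_def])
  show "gp k \<in> borel_measurable (hist k)"
    using *[OF pb_adapted] initial_measurable(2)[of k] by (cases "k = 0") (auto simp: gp_def[abs_def])
qed

lemma grad_inner_measurable:
  assumes "k \<le> L" "j \<in> J"
  shows "(\<lambda>\<omega>. grad (\<psi> j) (gx k \<omega>) \<bullet> gp k \<omega>) \<in> borel_measurable (hist k)"
  using measurable_compose[OF grid_measurable(1) grad_\<psi>_measurable] grid_measurable(2) assms
  by (intro borel_measurable_inner) auto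

lemma noise_measurable: "k < L \<Longrightarrow> noise k \<in> borel_measurable (hist (Suc k))"
  unfolding noise_def[abs_def]
  using weight_measurable_hist measurable_hist_mono[OF _ grad_inner_measurable, of k "Suc k"]
  by (intro borel_measurable_times borel_measurable_const borel_measurable_sum) auto

lemma mart_measurable: "k \<le> L \<Longrightarrow> mart k \<in> borel_measurable (hist k)"
  unfolding mart_def[abs_def]
  using measurable_hist_mono[OF _ noise_measurable, of _ k]
  by (intro borel_measurable_times borel_measurable_const borel_measurable_sum) auto

lemma noise_eq:
  assumes "k < L" "\<omega> \<in> space P"
  shows "noise k \<omega> = grad_fluct (\<xi> (Suc k) \<omega>) (gx k \<omega>) \<bullet> gp k \<omega>"
  unfolding grad_fluct_eq_weighted_sum[OF \<xi>_subset[OF assms]] noise_def weight_def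
  by (simp add: inner_sum_left)

end

subsection \<open>Moments and the martingale part\<close>

lemma power4_add_le: "(a + b) ^ 4 \<le> 8 * (a ^ 4 + b ^ 4)" for a b :: real
proof -
  have sq: "(c + d)\<^sup>2 \<le> 2 * (c\<^sup>2 + d\<^sup>2)" for c d :: real
    using sum_squares_bound[of c d] by (simp add: power2_sum)
  have "((a + b)\<^sup>2)\<^sup>2 \<le> (2 * (a\<^sup>2 + b\<^sup>2))\<^sup>2"
    by (intro power_mono sq) auto
  also have "\<dots> = 4 * (a\<^sup>2 + b\<^sup>2)\<^sup>2"
    unfolding power_mult_distrib by simp
  also have "\<dots> \<le> 4 * (2 * ((a\<^sup>2)\<^sup>2 + (b\<^sup>2)\<^sup>2))"
    by (intro mult_left_mono sq) auto
  finally show ?thesis by simp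
qed

definition rem_const :: "real \<Rightarrow> real \<Rightarrow> real" where
  "rem_const m M = 2 * M / m\<^sup>2 + 4 * M\<^sup>2 / m"

text \<open>\<open>mom2\<close> and \<open>mom4\<close> are the factors of
  \<open>1 + T\<^sup>2\<close> and of its square in \<open>bd_moments\<close>; their numerals come
  from the elementary inequalities used there.\<close>

definition mom2 :: "real \<Rightarrow> real" where "mom2 M = 3 + 2 * M + 8 * M\<^sup>2"
definition mom4 :: "real \<Rightarrow> real" where "mom4 M = 2 + 16 * M + 256 * M ^ 4"

text \<open>One summand for the martingale variance and one for the squared remainder, each doubled
  by (a + r)^2 \<le> 2 a^2 + 2 r^2.\<close>

definition sq_const :: "real \<Rightarrow> real \<Rightarrow> real" where
  "sq_const m M = 8 * M\<^sup>2 / m\<^sup>2 * mom2 M + 2 * (rem_const m M)\<^sup>2 * mom4 M"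

context random_batch begin

section \<open>Almost sure bounds along the batch path\<close>

definition en where "en k \<omega> = energy (gx k \<omega>) (gp k \<omega>)"

lemma rem_const_nonneg: "rem_const m M \<ge> 0"
  using M_nonneg m_pos by (simp add: rem_const_def)

text \<open>The remainder estimate stays conditional on a momentum bound by \<open>bd\<close>, since
  that bound results from iterating the first conclusion over \<open>k\<close>.\<close>

lemma AE_batch_steps:
  "AE \<omega> in P. \<forall>k<L. norm (gp (Suc k) \<omega>) \<le> norm (gp k \<omega>) + 2 * M * \<Delta>t \<and>
    \<bar>noise k \<omega>\<bar> \<le> 2 * M * norm (gp k \<omega>) \<and>
    (norm (gp k \<omega>) + 2 * M * \<Delta>t \<le> bd \<omega> \<longrightarrow>
      \<bar>en (Suc k) \<omega> - en k \<omega> - \<Delta>t / m * noise k \<omega>\<bar> \<le> rem_const m M * \<Delta>t\<^sup>2 * (1 + (bd \<omega>)\<^sup>2))"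
  using batch_sol AE_card_\<xi> AE_space
proof eventually_elim
  case (elim \<omega>)
  have sol: "batch_solution m V \<psi> s L \<Delta>t (\<lambda>l. \<xi> l \<omega>) (\<lambda>t. xb t \<omega>) (\<lambda>t. pb t \<omega>)"
    and init: "xb 0 \<omega> = X0 \<omega>" "pb 0 \<omega> = P0 \<omega>" and \<omega>: "\<omega> \<in> space P"
    using elim by auto
  have grid: "gx k \<omega> = xb (real k * \<Delta>t) \<omega>" "gp k \<omega> = pb (real k * \<Delta>t) \<omega>" for k
    using init by (auto simp: gx_def gp_def)
  show ?case
  proof (intro allI impI)
    fix k assume k: "k < L"
    define a b where "a = real k * \<Delta>t" and "b = real (Suc k) * \<Delta>t"
    have ab: "a < b" "b - a = \<Delta>t" using \<Delta>t_pos by (auto simp: a_def b_def algebra_simps)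
    let ?S = "\<xi> (Suc k) \<omega>"
    have S: "?S \<subseteq> J" "card ?S = s"
      using \<xi>_subset[OF k \<omega>] elim(2) k by auto
    have "b \<le> real L * \<Delta>t" unfolding b_def using k \<Delta>t_pos by (intro mult_right_mono) auto
    moreover have "0 \<le> a" using \<Delta>t_pos by (simp add: a_def)
    ultimately have sub: "{a..b} \<subseteq> {0..real L * \<Delta>t}" by auto
    have cont: "continuous_on {a..b} (\<lambda>t. xb t \<omega>)" "continuous_on {a..b} (\<lambda>t. pb t \<omega>)"
      using sol continuous_on_subset[OF _ sub] by (auto simp: batch_solution_def)
    have at: "at t within {a..<b} = at t" if "t \<in> {a<..<b}" for t
      using that by (intro at_within_open_subset[of _ "{a<..<b}"]) auto
    have "\<forall>t\<in>{a..<b}.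
        ((\<lambda>t. xb t \<omega>) has_vector_derivative (1 / m) *\<^sub>R pb t \<omega>) (at t within {a..<b}) \<and>
        ((\<lambda>t. pb t \<omega>) has_vector_derivative
           - grad V (xb t \<omega>) + (1 / real s) *\<^sub>R (\<Sum>j\<in>?S. grad (\<psi> j) (xb t \<omega>))) (at t within {a..<b})"
      using sol k unfolding batch_solution_def a_def b_def
      by (auto dest!: bspec[of _ _ "Suc k"])
    then have d: "((\<lambda>t. xb t \<omega>) has_vector_derivative (1 / m) *\<^sub>R pb t \<omega>) (at t)"
      "((\<lambda>t. pb t \<omega>) has_vector_derivative
           - grad V (xb t \<omega>) + (1 / real s) *\<^sub>R (\<Sum>j\<in>?S. grad (\<psi> j) (xb t \<omega>))) (at t)"
      if "t \<in> {a<..<b}" for t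
      using that by (auto simp flip: at[OF that])
    note step = batch_step[OF ab(1) S cont d, unfolded ab(2)]
    have *: "xb a \<omega> = gx k \<omega>" "pb a \<omega> = gp k \<omega>" "xb b \<omega> = gx (Suc k) \<omega>" "pb b \<omega> = gp (Suc k) \<omega>"
      unfolding grid a_def b_def by auto
    have "\<bar>grad_fluct ?S (gx k \<omega>) \<bullet> gp k \<omega>\<bar> \<le> 2 * M * norm (gp k \<omega>)"
      using Cauchy_Schwarz_ineq2[of "grad_fluct ?S (gx k \<omega>)" "gp k \<omega>"]
        mult_right_mono[OF norm_grad_fluct_le[OF S] norm_ge_zero, of "gx k \<omega>" "gp k \<omega>"] by linarith
    \<comment> \<open>The momentum bound does not mention \<open>B\<close>, so its use takes the
      smallest admissible value; the remainder estimate takes \<open>bd\<close>, the same for all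
      \<open>k\<close>.\<close>
    then show "norm (gp (Suc k) \<omega>) \<le> norm (gp k \<omega>) + 2 * M * \<Delta>t \<and>
      \<bar>noise k \<omega>\<bar> \<le> 2 * M * norm (gp k \<omega>) \<and>
      (norm (gp k \<omega>) + 2 * M * \<Delta>t \<le> bd \<omega> \<longrightarrow>
      \<bar>en (Suc k) \<omega> - en k \<omega> - \<Delta>t / m * noise k \<omega>\<bar> \<le> rem_const m M * \<Delta>t\<^sup>2 * (1 + (bd \<omega>)\<^sup>2))"
      using step(1)[of "norm (pb a \<omega>) + 2 * M * \<Delta>t"] step(2)[of "bd \<omega>"]
      unfolding * en_def rem_const_def noise_eq[OF k \<omega>] by auto
  qed
qed

text \<open>Each step adds at most \<open>2 * M * \<Delta>t\<close> to the momentum, so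
  \<open>bd\<close> dominates it up to time \<open>T\<close> and the conditional remainder estimates
  apply; L of them, of order \<Delta>t^2 each, add up to order T \<Delta>t.\<close>

lemma AE_path_bounds:
  "AE \<omega> in P. (\<forall>k\<le>L. norm (gp k \<omega>) \<le> bd \<omega>) \<and> (\<forall>k<L. \<bar>noise k \<omega>\<bar> \<le> 2 * M * bd \<omega>) \<and>
    \<bar>en L \<omega> - en 0 \<omega> - mart L \<omega>\<bar> \<le> rem_const m M * (T * \<Delta>t) * (1 + (bd \<omega>)\<^sup>2)"
  using AE_batch_steps
proof eventually_elim
  case (elim \<omega>)
  have p: "norm (gp k \<omega>) \<le> norm (P0 \<omega>) + 2 * M * (real k * \<Delta>t)" if "k \<le> L" for k
    using that
  proof (induction k)
    case (Suc k)
    then have "norm (gp (Suc k) \<omega>) \<le> norm (gp k \<omega>) + 2 * M * \<Delta>t" using elim by auto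
    with Suc show ?case by (simp add: algebra_simps)
  qed (simp add: gp_def)
  have kL: "2 * M * (real k * \<Delta>t) \<le> 2 * M * T" if "k \<le> L" for k
    unfolding T_def using that M_nonneg \<Delta>t_pos by (intro mult_left_mono mult_right_mono) auto
  have bd: "norm (gp k \<omega>) \<le> bd \<omega>" if "k \<le> L" for k
    using p[OF that] kL[OF that] by (simp add: bd_def)
  have noise: "\<bar>noise k \<omega>\<bar> \<le> 2 * M * bd \<omega>" if "k < L" for k
  proof -
    have "2 * M * norm (gp k \<omega>) \<le> 2 * M * bd \<omega>"
      using bd[of k] that M_nonneg by (intro mult_left_mono) auto
    then show ?thesis using elim that by fastforce
  qed
  have "\<bar>en k \<omega> - en 0 \<omega> - mart k \<omega>\<bar> \<le> real k * (rem_const m M * \<Delta>t\<^sup>2 * (1 + (bd \<omega>)\<^sup>2))" if "k \<le> L" for k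
    using that
  proof (induction k)
    case (Suc k)
    \<comment> \<open>One more step beyond \<open>k\<close> still fits under \<open>bd\<close>
      because \<open>Suc k \<le> L\<close>; hence \<open>kL\<close> is taken at
      \<open>Suc k\<close>.\<close>
    have "norm (gp k \<omega>) + 2 * M * \<Delta>t \<le> bd \<omega>"
      using p[of k] kL[of "Suc k"] Suc.prems by (simp add: bd_def algebra_simps)
    then have "\<bar>en (Suc k) \<omega> - en k \<omega> - \<Delta>t / m * noise k \<omega>\<bar> \<le> rem_const m M * \<Delta>t\<^sup>2 * (1 + (bd \<omega>)\<^sup>2)"
      using elim Suc.prems by auto
    moreover have "mart (Suc k) \<omega> = mart k \<omega> + \<Delta>t / m * noise k \<omega>"
      by (simp add: mart_def)
    moreover have "real (Suc k) * (rem_const m M * \<Delta>t\<^sup>2 * (1 + (bd \<omega>)\<^sup>2))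
        = real k * (rem_const m M * \<Delta>t\<^sup>2 * (1 + (bd \<omega>)\<^sup>2)) + rem_const m M * \<Delta>t\<^sup>2 * (1 + (bd \<omega>)\<^sup>2)"
      by (simp add: distrib_right)
    ultimately show ?case using Suc.IH Suc.prems by linarith
  qed (simp add: mart_def)
  from this[of L] bd noise show ?case
    by (simp add: T_def power2_eq_square mult_ac)
qed

section \<open>Moments of the momentum bound\<close>

lemma bd_nonneg: "bd \<omega> \<ge> 0"
  using M_nonneg T_pos by (simp add: bd_def)

lemma bd_measurable: "bd \<in> borel_measurable P"
  unfolding bd_def[abs_def] using P0 by measurable

lemma mom4_nonneg: "mom4 M \<ge> 0"
  using M_nonneg by (simp add: mom4_def)

text \<open>Everything reduces to the fourth moment of \<open>P0\<close>: the squared expression by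
  (a + b)^4 \<le> 8 (a^4 + b^4), the second moment by u^2 \<le> 1 + u^4.\<close>

lemma bd_moments:
  shows "integrable P (\<lambda>\<omega>. (1 + (bd \<omega>)\<^sup>2)\<^sup>2)"
    and "(\<integral>\<omega>. (1 + (bd \<omega>)\<^sup>2)\<^sup>2 \<partial>P) \<le> mom4 M * (1 + T\<^sup>2)\<^sup>2"
    and "integrable P (\<lambda>\<omega>. (bd \<omega>)\<^sup>2)"
    and "(\<integral>\<omega>. 1 + (bd \<omega>)\<^sup>2 \<partial>P) \<le> mom2 M * (1 + T\<^sup>2)"
proof -
  have q: "(bd \<omega>) ^ 4 \<le> 8 * norm (P0 \<omega>) ^ 4 + 128 * M ^ 4 * T ^ 4" for \<omega>
    using power4_add_le[of "norm (P0 \<omega>)" "2 * M * T"] by (simp add: bd_def power_mult_distrib)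
  have "(1 + (bd \<omega>)\<^sup>2)\<^sup>2 \<le> 2 + 2 * (bd \<omega>) ^ 4" for \<omega>
    using sum_squares_bound[of 1 "(bd \<omega>)\<^sup>2"] by (simp add: power2_sum)
  then have le4: "(1 + (bd \<omega>)\<^sup>2)\<^sup>2 \<le> 16 * norm (P0 \<omega>) ^ 4 + (2 + 256 * M ^ 4 * T ^ 4)" for \<omega>
    using order_trans[OF _ add_left_mono[OF mult_left_mono[OF q]], of "(1 + (bd \<omega>)\<^sup>2)\<^sup>2" 2 2 \<omega>]
    by (simp add: algebra_simps)
  have dom4: "integrable P (\<lambda>\<omega>. 16 * norm (P0 \<omega>) ^ 4 + (2 + 256 * M ^ 4 * T ^ 4))"
    using P0_int by simp
  show int4: "integrable P (\<lambda>\<omega>. (1 + (bd \<omega>)\<^sup>2)\<^sup>2)"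
    using bd_measurable le4 by (intro Bochner_Integration.integrable_bound[OF dom4]) auto
  have "(\<integral>\<omega>. (1 + (bd \<omega>)\<^sup>2)\<^sup>2 \<partial>P) \<le> (\<integral>\<omega>. 16 * norm (P0 \<omega>) ^ 4 + (2 + 256 * M ^ 4 * T ^ 4) \<partial>P)"
    using int4 dom4 le4 by (intro integral_mono)
  also have "\<dots> = 16 * (\<integral>\<omega>. norm (P0 \<omega>) ^ 4 \<partial>P) + (2 + 256 * M ^ 4 * T ^ 4)"
    using P0_int by (simp add: prob_space)
  also have "\<dots> \<le> (16 * M + 2) * 1 + 256 * M ^ 4 * T ^ 4"
    using P0_moment by simp
  also have "\<dots> \<le> (16 * M + 2) * (1 + T\<^sup>2)\<^sup>2 + 256 * M ^ 4 * (1 + T\<^sup>2)\<^sup>2"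
  proof -
    have "T ^ 4 \<le> (1 + T\<^sup>2)\<^sup>2" "1 \<le> (1 + T\<^sup>2)\<^sup>2"
      by (auto simp: power2_sum simp flip: power_mult)
    then show ?thesis using M_nonneg by (intro add_mono mult_left_mono) auto
  qed
  finally show "(\<integral>\<omega>. (1 + (bd \<omega>)\<^sup>2)\<^sup>2 \<partial>P) \<le> mom4 M * (1 + T\<^sup>2)\<^sup>2"
    by (simp add: mom4_def algebra_simps)
  have le2: "1 + (bd \<omega>)\<^sup>2 \<le> 2 * norm (P0 \<omega>) ^ 4 + (3 + 8 * M\<^sup>2 * T\<^sup>2)" for \<omega>
  proof -
    have "(bd \<omega>)\<^sup>2 \<le> 2 * (norm (P0 \<omega>))\<^sup>2 + 8 * M\<^sup>2 * T\<^sup>2"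
      using sum_squares_bound[of "norm (P0 \<omega>)" "2 * M * T"]
      by (simp add: bd_def power2_sum power_mult_distrib)
    moreover have "(norm (P0 \<omega>))\<^sup>2 \<le> 1 + norm (P0 \<omega>) ^ 4"
    proof -
      have "2 * (norm (P0 \<omega>))\<^sup>2 \<le> 1 + norm (P0 \<omega>) ^ 4"
        using sum_squares_bound[of 1 "(norm (P0 \<omega>))\<^sup>2"] by simp
      then show ?thesis
        using zero_le_power2[of "norm (P0 \<omega>)"] by linarith
    qed
    ultimately show ?thesis by linarith
  qed
  have dom2: "integrable P (\<lambda>\<omega>. 2 * norm (P0 \<omega>) ^ 4 + (3 + 8 * M\<^sup>2 * T\<^sup>2))"
    using P0_int by simp
  have "(bd \<omega>)\<^sup>2 \<le> 2 * norm (P0 \<omega>) ^ 4 + (3 + 8 * M\<^sup>2 * T\<^sup>2)" for \<omega>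
    using le2[of \<omega>] by linarith
  then show int2: "integrable P (\<lambda>\<omega>. (bd \<omega>)\<^sup>2)"
    using bd_measurable by (intro Bochner_Integration.integrable_bound[OF dom2]) auto
  have "(\<integral>\<omega>. 1 + (bd \<omega>)\<^sup>2 \<partial>P) \<le> (\<integral>\<omega>. 2 * norm (P0 \<omega>) ^ 4 + (3 + 8 * M\<^sup>2 * T\<^sup>2) \<partial>P)"
    using int2 dom2 le2 by (intro integral_mono) auto
  also have "\<dots> = 2 * (\<integral>\<omega>. norm (P0 \<omega>) ^ 4 \<partial>P) + (3 + 8 * M\<^sup>2 * T\<^sup>2)"
    using P0_int by (simp add: prob_space)
  also have "\<dots> \<le> (2 * M + 3) * 1 + 8 * M\<^sup>2 * T\<^sup>2"
    using P0_moment by simp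
  also have "\<dots> \<le> (2 * M + 3) * (1 + T\<^sup>2) + 8 * M\<^sup>2 * (1 + T\<^sup>2)"
    using M_nonneg by (intro add_mono mult_left_mono) auto
  finally show "(\<integral>\<omega>. 1 + (bd \<omega>)\<^sup>2 \<partial>P) \<le> mom2 M * (1 + T\<^sup>2)"
    by (simp add: mom2_def algebra_simps)
qed

lemma bd_integrable: "integrable P bd"
proof (rule Bochner_Integration.integrable_bound)
  show "integrable P (\<lambda>\<omega>. 1 + (bd \<omega>)\<^sup>2)"
    using bd_moments(3) by simp
  have "\<bar>bd \<omega>\<bar> \<le> 1 + (bd \<omega>)\<^sup>2" for \<omega>
    using sum_squares_bound[of 1 "bd \<omega>"] bd_nonneg[of \<omega>] by simp
  then show "AE \<omega> in P. norm (bd \<omega>) \<le> norm (1 + (bd \<omega>)\<^sup>2)"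
    by simp
qed (rule bd_measurable)

text \<open>Splitting \<open>noise k\<close> into weights leaves finitely many uses of
  \<open>integral_weight_mult\<close>; the condition involves \<open>bd\<close> because each frozen
  factor is at most \<open>M * bd\<close>. The choice \<open>Z = mart k\<close> will give
  orthogonality, and the derivative of the test function at the initial energy will give the weak
  estimate.\<close>

lemma integral_mult_noise:
  assumes k: "k < L" and Z: "Z \<in> borel_measurable (hist k)" "integrable P (\<lambda>\<omega>. Z \<omega> * bd \<omega>)"
  shows "integrable P (\<lambda>\<omega>. Z \<omega> * noise k \<omega>)" "(\<integral>\<omega>. Z \<omega> * noise k \<omega> \<partial>P) = 0"
proof -
  define f where "f j \<omega> = Z \<omega> * (grad (\<psi> j) (gx k \<omega>) \<bullet> gp k \<omega>)" for j \<omega>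
  have f: "f j \<in> borel_measurable (hist k)" if "j \<in> J" for j
    unfolding f_def[abs_def] using Z(1) grad_inner_measurable[of k j] that k
    by (intro borel_measurable_times) auto
  have fi: "integrable P (f j)" if j: "j \<in> J" for j
  proof (rule Bochner_Integration.integrable_bound)
    show "integrable P (\<lambda>\<omega>. M * (Z \<omega> * bd \<omega>))"
      using Z(2) by simp
    show "f j \<in> borel_measurable P"
      using f[OF j] measurable_hist_P[of k] k by auto
    show "AE \<omega> in P. norm (f j \<omega>) \<le> norm (M * (Z \<omega> * bd \<omega>))"
      using AE_path_bounds
    proof eventually_elim
      case (elim \<omega>)
      have "\<bar>grad (\<psi> j) (gx k \<omega>) \<bullet> gp k \<omega>\<bar> \<le> norm (grad (\<psi> j) (gx k \<omega>)) * norm (gp k \<omega>)"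
        by (rule Cauchy_Schwarz_ineq2)
      also have "\<dots> \<le> M * bd \<omega>"
        using \<psi>_bound[OF j] elim k M_nonneg by (intro mult_mono) auto
      finally have "\<bar>Z \<omega>\<bar> * \<bar>grad (\<psi> j) (gx k \<omega>) \<bullet> gp k \<omega>\<bar> \<le> \<bar>Z \<omega>\<bar> * (M * bd \<omega>)"
        by (intro mult_left_mono) auto
      then show ?case
        using M_nonneg bd_nonneg[of \<omega>] by (simp add: f_def abs_mult mult_ac)
    qed
  qed
  have eq: "Z \<omega> * noise k \<omega> = (1 / real s) * (\<Sum>j\<in>J. f j \<omega> * weight k j \<omega>)" for \<omega>
    unfolding noise_def f_def by (simp add: sum_distrib_left mult_ac)
  note w = integral_weight_mult[OF k _ f fi]
  show "integrable P (\<lambda>\<omega>. Z \<omega> * noise k \<omega>)"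
    unfolding eq using w(1) by (intro integrable_mult_right Bochner_Integration.integrable_sum)
  show "(\<integral>\<omega>. Z \<omega> * noise k \<omega> \<partial>P) = 0"
    unfolding eq using w by (simp add: Bochner_Integration.integral_sum)
qed

lemma noise_measurable_P: "k < L \<Longrightarrow> noise k \<in> borel_measurable P"
  using measurable_hist_P[OF _ noise_measurable] by auto

lemma mart_measurable_P: "k \<le> L \<Longrightarrow> mart k \<in> borel_measurable P"
  using measurable_hist_P[OF _ mart_measurable] by auto

text \<open>A crude bound without cancellation; it serves the integrability of
  \<open>mart k * bd\<close>, while the sharp size comes from orthogonality.\<close>

lemma AE_mart_bound:
  assumes "k \<le> L"
  shows "AE \<omega> in P. \<bar>mart k \<omega>\<bar> \<le> real k * (\<Delta>t / m * (2 * M)) * bd \<omega>"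
  using AE_path_bounds
proof eventually_elim
  case (elim \<omega>)
  have "\<bar>mart k \<omega>\<bar> \<le> (\<Sum>i<k. \<bar>\<Delta>t / m * noise i \<omega>\<bar>)"
    unfolding mart_def by (rule sum_abs)
  also have "\<dots> \<le> (\<Sum>i<k. \<Delta>t / m * (2 * M * bd \<omega>))"
  proof (intro sum_mono)
    fix i assume "i \<in> {..<k}"
    then have "\<bar>noise i \<omega>\<bar> \<le> 2 * M * bd \<omega>" using elim assms by auto
    then show "\<bar>\<Delta>t / m * noise i \<omega>\<bar> \<le> \<Delta>t / m * (2 * M * bd \<omega>)"
      using m_pos \<Delta>t_pos by (simp add: abs_mult divide_right_mono)
  qed
  finally show ?case by (simp add: mult_ac)
qed

lemma integrable_bd_square_bound:
  fixes f :: "'w \<Rightarrow> real"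
  assumes "f \<in> borel_measurable P" "AE \<omega> in P. \<bar>f \<omega>\<bar> \<le> c * (bd \<omega>)\<^sup>2"
  shows "integrable P f"
proof (rule Bochner_Integration.integrable_bound)
  show "integrable P (\<lambda>\<omega>. c * (bd \<omega>)\<^sup>2)"
    using bd_moments(3) by simp
  show "AE \<omega> in P. norm (f \<omega>) \<le> norm (c * (bd \<omega>)\<^sup>2)"
    using assms(2) by eventually_elim simp
qed (rule assms(1))

text \<open>The cross term vanishes since \<open>mart k\<close> belongs to the past of batch
  \<open>Suc k\<close>; squares therefore add, and the growth is linear in \<open>k\<close> rather
  than quadratic. Integrability is part of the induction because the integral of the expanded square
  has to be split.\<close>

lemma mart_second_moment:
  assumes "k \<le> L"
  shows "integrable P (\<lambda>\<omega>. (mart k \<omega>)\<^sup>2) \<and>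
    (\<integral>\<omega>. (mart k \<omega>)\<^sup>2 \<partial>P) \<le> real k * ((\<Delta>t / m * (2 * M))\<^sup>2 * (\<integral>\<omega>. (bd \<omega>)\<^sup>2 \<partial>P))"
  using assms
proof (induction k)
  case 0
  then show ?case by (simp add: mart_def)
next
  case (Suc k)
  then have k: "k < L" "k \<le> L" by auto
  let ?c = "\<Delta>t / m" and ?I = "\<integral>\<omega>. (bd \<omega>)\<^sup>2 \<partial>P"
  have noise_sq: "AE \<omega> in P. (?c * noise k \<omega>)\<^sup>2 \<le> (?c * (2 * M))\<^sup>2 * (bd \<omega>)\<^sup>2"
    using AE_path_bounds
  proof eventually_elim
    case (elim \<omega>)
    then have "\<bar>noise k \<omega>\<bar> \<le> 2 * M * bd \<omega>" using k by auto
    then have "(noise k \<omega>)\<^sup>2 \<le> (2 * M * bd \<omega>)\<^sup>2"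
      by (metis abs_ge_zero power2_abs power_mono)
    then have "?c\<^sup>2 * (noise k \<omega>)\<^sup>2 \<le> ?c\<^sup>2 * (2 * M * bd \<omega>)\<^sup>2"
      by (intro mult_left_mono) auto
    then show ?case by (simp only: power_mult_distrib mult_ac)
  qed
  have i1: "integrable P (\<lambda>\<omega>. (?c * noise k \<omega>)\<^sup>2)"
    using noise_sq noise_measurable_P[OF k(1)] by (intro integrable_bd_square_bound) auto
  have "integrable P (\<lambda>\<omega>. mart k \<omega> * bd \<omega>)"
  proof (rule integrable_bd_square_bound)
    show "AE \<omega> in P. \<bar>mart k \<omega> * bd \<omega>\<bar> \<le> real k * (?c * (2 * M)) * (bd \<omega>)\<^sup>2"
      using AE_mart_bound[OF k(2)]
    proof eventually_elim
      case (elim \<omega>)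
      from mult_right_mono[OF this bd_nonneg[of \<omega>]] show ?case
        using bd_nonneg[of \<omega>] by (simp add: abs_mult power2_eq_square mult_ac)
    qed
  qed (use mart_measurable_P[OF k(2)] bd_measurable in auto)
  note cross = integral_mult_noise[OF k(1) mart_measurable[OF k(2)] this]
  have i2: "integrable P (\<lambda>\<omega>. 2 * ?c * (mart k \<omega> * noise k \<omega>))"
    using cross(1) by (intro integrable_mult_right)
  have eq: "(mart (Suc k) \<omega>)\<^sup>2
      = (mart k \<omega>)\<^sup>2 + 2 * ?c * (mart k \<omega> * noise k \<omega>) + (?c * noise k \<omega>)\<^sup>2" for \<omega>
    by (simp add: mart_def power2_sum algebra_simps)
  have i0: "integrable P (\<lambda>\<omega>. (mart k \<omega>)\<^sup>2)" and
    IH: "(\<integral>\<omega>. (mart k \<omega>)\<^sup>2 \<partial>P) \<le> real k * ((?c * (2 * M))\<^sup>2 * ?I)"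
    using Suc.IH[OF k(2)] by auto
  have "(\<integral>\<omega>. (mart (Suc k) \<omega>)\<^sup>2 \<partial>P) = (\<integral>\<omega>. (mart k \<omega>)\<^sup>2 \<partial>P) + (\<integral>\<omega>. (?c * noise k \<omega>)\<^sup>2 \<partial>P)"
  proof -
    have "(\<integral>\<omega>. 2 * ?c * (mart k \<omega> * noise k \<omega>) \<partial>P) = 0"
      using cross(2) by (subst integral_mult_right_zero) simp
    then show ?thesis
      unfolding eq Bochner_Integration.integral_add[OF Bochner_Integration.integrable_add[OF i0 i2] i1]
        Bochner_Integration.integral_add[OF i0 i2] by simp
  qed
  also have "(\<integral>\<omega>. (?c * noise k \<omega>)\<^sup>2 \<partial>P) \<le> (\<integral>\<omega>. (?c * (2 * M))\<^sup>2 * (bd \<omega>)\<^sup>2 \<partial>P)"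
    using noise_sq bd_moments(3) by (intro integral_mono_AE i1 integrable_mult_right)
  also have "\<dots> = (?c * (2 * M))\<^sup>2 * ?I"
    by (rule integral_mult_right_zero)
  finally have "(\<integral>\<omega>. (mart (Suc k) \<omega>)\<^sup>2 \<partial>P) \<le> real (Suc k) * ((?c * (2 * M))\<^sup>2 * ?I)"
    using IH by (simp only: of_nat_Suc distrib_right mult_1_left) linarith
  moreover have "integrable P (\<lambda>\<omega>. (mart (Suc k) \<omega>)\<^sup>2)"
    unfolding eq by (intro Bochner_Integration.integrable_add i0 i1 i2)
  ultimately show ?case by blast
qed

section \<open>Second moment and weak estimate of the energy error\<close>

lemma energy_error_decomposition:
  "AE \<omega> in P. (en L \<omega> - en 0 \<omega>)\<^sup>2
    \<le> 2 * (mart L \<omega>)\<^sup>2 + 2 * (rem_const m M * (T * \<Delta>t))\<^sup>2 * (1 + (bd \<omega>)\<^sup>2)\<^sup>2"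
  using AE_path_bounds
proof eventually_elim
  case (elim \<omega>)
  define r where "r = en L \<omega> - en 0 \<omega> - mart L \<omega>"
  have "\<bar>r\<bar> \<le> rem_const m M * (T * \<Delta>t) * (1 + (bd \<omega>)\<^sup>2)"
    using elim by (simp add: r_def)
  then have "r\<^sup>2 \<le> (rem_const m M * (T * \<Delta>t) * (1 + (bd \<omega>)\<^sup>2))\<^sup>2"
    by (metis abs_ge_zero power2_abs power_mono)
  moreover have "(mart L \<omega> + r)\<^sup>2 \<le> 2 * (mart L \<omega>)\<^sup>2 + 2 * r\<^sup>2"
    using sum_squares_bound[of "mart L \<omega>" r] by (simp add: power2_sum)
  moreover have "en L \<omega> - en 0 \<omega> = mart L \<omega> + r"
    by (simp add: r_def)
  ultimately show ?case
    by (simp add: power_mult_distrib)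
qed

lemma en_measurable: "k \<le> L \<Longrightarrow> en k \<in> borel_measurable (hist k)"
  unfolding en_def[abs_def] using grid_measurable by (intro energy_measurable)

lemma en_measurable_P: "k \<le> L \<Longrightarrow> en k \<in> borel_measurable P"
  using measurable_hist_P[OF _ en_measurable] by auto

lemma energy_error_second_moment:
  assumes small: "T * (1 + T\<^sup>2) * \<Delta>t \<le> 1"
  shows "integrable P (\<lambda>\<omega>. (en L \<omega> - en 0 \<omega>)\<^sup>2)"
    and "(\<integral>\<omega>. (en L \<omega> - en 0 \<omega>)\<^sup>2 \<partial>P) \<le> sq_const m M * (T * (1 + T\<^sup>2) * \<Delta>t)"
proof -
  define Q where "Q = T * (1 + T\<^sup>2) * \<Delta>t"
  have Q: "0 \<le> Q" "Q \<le> 1"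
    using small T_pos \<Delta>t_pos by (auto simp: Q_def)
  let ?R = "(rem_const m M * (T * \<Delta>t))\<^sup>2"
  have mart: "integrable P (\<lambda>\<omega>. (mart L \<omega>)\<^sup>2)"
    "(\<integral>\<omega>. (mart L \<omega>)\<^sup>2 \<partial>P) \<le> real L * ((\<Delta>t / m * (2 * M))\<^sup>2 * (\<integral>\<omega>. (bd \<omega>)\<^sup>2 \<partial>P))"
    using mart_second_moment[of L] by auto
  have dom: "integrable P (\<lambda>\<omega>. 2 * (mart L \<omega>)\<^sup>2 + 2 * ?R * (1 + (bd \<omega>)\<^sup>2)\<^sup>2)"
    using mart(1) bd_moments(1) by (intro Bochner_Integration.integrable_add integrable_mult_right)
  show int: "integrable P (\<lambda>\<omega>. (en L \<omega> - en 0 \<omega>)\<^sup>2)"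
  proof (rule Bochner_Integration.integrable_bound[OF dom])
    show "(\<lambda>\<omega>. (en L \<omega> - en 0 \<omega>)\<^sup>2) \<in> borel_measurable P"
      using en_measurable_P[of L] en_measurable_P[of 0] by auto
    show "AE \<omega> in P. norm ((en L \<omega> - en 0 \<omega>)\<^sup>2)
        \<le> norm (2 * (mart L \<omega>)\<^sup>2 + 2 * ?R * (1 + (bd \<omega>)\<^sup>2)\<^sup>2)"
      using energy_error_decomposition by eventually_elim simp
  qed
  have "(\<integral>\<omega>. (bd \<omega>)\<^sup>2 \<partial>P) \<le> (\<integral>\<omega>. 1 + (bd \<omega>)\<^sup>2 \<partial>P)"
    using bd_moments(3) by (intro integral_mono) auto
  also have "\<dots> \<le> mom2 M * (1 + T\<^sup>2)"
    by (rule bd_moments(4))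
  finally have "real L * ((\<Delta>t / m * (2 * M))\<^sup>2 * (\<integral>\<omega>. (bd \<omega>)\<^sup>2 \<partial>P))
      \<le> real L * ((\<Delta>t / m * (2 * M))\<^sup>2 * (mom2 M * (1 + T\<^sup>2)))"
    by (intro mult_left_mono) auto
  \<comment> \<open>L \<Delta>t^2 = T \<Delta>t turns L variances of order \<Delta>t^2 (1 + T^2)
    into order Q.\<close>
  also have "\<dots> = 4 * M\<^sup>2 / m\<^sup>2 * mom2 M * Q"
    by (simp add: Q_def T_def power2_eq_square)
  finally have m2: "(\<integral>\<omega>. (mart L \<omega>)\<^sup>2 \<partial>P) \<le> 4 * M\<^sup>2 / m\<^sup>2 * mom2 M * Q"
    using mart(2) by linarith
  have "?R * (\<integral>\<omega>. (1 + (bd \<omega>)\<^sup>2)\<^sup>2 \<partial>P) \<le> ?R * (mom4 M * (1 + T\<^sup>2)\<^sup>2)"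
    by (intro mult_left_mono bd_moments(2)) auto
  \<comment> \<open>The factor (1 + T^2)^2 from the fourth moment completes (T \<Delta>t)^2 to Q^2;
    the smallness hypothesis then gives Q^2 \<le> Q.\<close>
  also have "\<dots> = (rem_const m M)\<^sup>2 * mom4 M * (Q * Q)"
    by (simp add: Q_def power2_eq_square)
  also have "\<dots> \<le> (rem_const m M)\<^sup>2 * mom4 M * Q"
    using Q mom4_nonneg by (intro mult_left_mono) (auto simp: mult_left_le_one_le)
  finally have r2: "?R * (\<integral>\<omega>. (1 + (bd \<omega>)\<^sup>2)\<^sup>2 \<partial>P) \<le> (rem_const m M)\<^sup>2 * mom4 M * Q" .
  have "(\<integral>\<omega>. (en L \<omega> - en 0 \<omega>)\<^sup>2 \<partial>P)
      \<le> (\<integral>\<omega>. 2 * (mart L \<omega>)\<^sup>2 + 2 * ?R * (1 + (bd \<omega>)\<^sup>2)\<^sup>2 \<partial>P)"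
    using energy_error_decomposition by (intro integral_mono_AE int dom)
  also have "\<dots> = 2 * (\<integral>\<omega>. (mart L \<omega>)\<^sup>2 \<partial>P) + 2 * (?R * (\<integral>\<omega>. (1 + (bd \<omega>)\<^sup>2)\<^sup>2 \<partial>P))"
    using mart(1) bd_moments(1)
    by (subst Bochner_Integration.integral_add) (auto simp only: integrable_mult_right integral_mult_right_zero mult.assoc)
  also have "\<dots> \<le> 2 * (4 * M\<^sup>2 / m\<^sup>2 * mom2 M * Q) + 2 * ((rem_const m M)\<^sup>2 * mom4 M * Q)"
    using m2 r2 by linarith
  also have "\<dots> = sq_const m M * Q"
    by (simp add: sq_const_def algebra_simps)
  finally show "(\<integral>\<omega>. (en L \<omega> - en 0 \<omega>)\<^sup>2 \<partial>P) \<le> sq_const m M * (T * (1 + T\<^sup>2) * \<Delta>t)"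
    by (simp add: Q_def)
qed

text \<open>Replacing the energy error by the martingale in the linear term costs only the
  remainder, whose mean is of order Q; the strong estimate applied to that term would give only the
  order of sqrt Q. Boundedness of \<open>\<phi>\<close> makes the difference integrable although the
  energies may not be.\<close>

lemma weak_energy_error:
  fixes \<phi> \<phi>' :: "real \<Rightarrow> real"
  assumes small: "T * (1 + T\<^sup>2) * \<Delta>t \<le> 1"
    and der: "\<And>y. (\<phi> has_field_derivative \<phi>' y) (at y)"
    and bounds: "\<And>y. \<bar>\<phi> y\<bar> \<le> A" "\<And>y. \<bar>\<phi>' y\<bar> \<le> A"
    and lip: "\<And>y z. \<bar>\<phi>' z - \<phi>' y\<bar> \<le> A * \<bar>z - y\<bar>"
    and meas: "\<phi>' \<in> borel_measurable borel"
  shows "integrable P (\<lambda>\<omega>. \<phi> (en L \<omega>) - \<phi> (en 0 \<omega>))"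
    and "\<bar>\<integral>\<omega>. \<phi> (en L \<omega>) - \<phi> (en 0 \<omega>) \<partial>P\<bar>
      \<le> A * (rem_const m M * mom2 M + sq_const m M) * (T * (1 + T\<^sup>2) * \<Delta>t)"
proof -
  define Q where "Q = T * (1 + T\<^sup>2) * \<Delta>t"
  have A: "A \<ge> 0" using bounds(1)[of 0] by linarith
  have "continuous_on UNIV \<phi>"
    using der DERIV_isCont by (auto simp: continuous_on_eq_continuous_at)
  then have \<phi>_meas: "\<phi> \<in> borel_measurable borel"
    by (rule borel_measurable_continuous_onI)
  show int: "integrable P (\<lambda>\<omega>. \<phi> (en L \<omega>) - \<phi> (en 0 \<omega>))"
  proof (rule integrable_const_bound[of _ "2 * A"])
    show "AE \<omega> in P. norm (\<phi> (en L \<omega>) - \<phi> (en 0 \<omega>)) \<le> 2 * A"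
    proof (rule AE_I2)
      show "norm (\<phi> (en L \<omega>) - \<phi> (en 0 \<omega>)) \<le> 2 * A" for \<omega>
        using bounds(1)[of "en L \<omega>"] bounds(1)[of "en 0 \<omega>"] by simp
    qed
    show "(\<lambda>\<omega>. \<phi> (en L \<omega>) - \<phi> (en 0 \<omega>)) \<in> borel_measurable P"
      using \<phi>_meas measurable_compose[OF en_measurable_P \<phi>_meas] by auto
  qed
  let ?Z = "\<lambda>\<omega>. \<phi>' (en 0 \<omega>)"
  \<comment> \<open>The initial energy is measurable for \<open>hist 0\<close>, hence for every
    \<open>hist k\<close>, so \<open>?Z\<close> is a past variable for all the noises at
    once.\<close>
  have Z: "?Z \<in> borel_measurable (hist k)" for k
    using measurable_compose[OF en_measurable[of 0] meas] measurable_hist_mono[of 0 k] by auto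
  have "integrable P (\<lambda>\<omega>. ?Z \<omega> * bd \<omega>)"
  proof (rule Bochner_Integration.integrable_bound)
    show "integrable P (\<lambda>\<omega>. A * bd \<omega>)"
      using bd_integrable by simp
    show "(\<lambda>\<omega>. ?Z \<omega> * bd \<omega>) \<in> borel_measurable P"
      using measurable_hist_P[OF _ Z[of 0]] bd_measurable by auto
    have "\<bar>?Z \<omega> * bd \<omega>\<bar> \<le> \<bar>A * bd \<omega>\<bar>" for \<omega>
      using mult_right_mono[OF bounds(2) bd_nonneg] A bd_nonneg by (simp add: abs_mult)
    then show "AE \<omega> in P. norm (?Z \<omega> * bd \<omega>) \<le> norm (A * bd \<omega>)"
      by simp
  qed
  note zn = integral_mult_noise[OF _ Z this]
  have eq: "?Z \<omega> * mart L \<omega> = (\<Sum>i<L. \<Delta>t / m * (?Z \<omega> * noise i \<omega>))" for \<omega>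
    by (simp add: mart_def sum_distrib_left mult_ac)
  have zm: "integrable P (\<lambda>\<omega>. ?Z \<omega> * mart L \<omega>)"
    unfolding eq using zn(1) by (intro Bochner_Integration.integrable_sum integrable_mult_right) auto
  have "(\<integral>\<omega>. ?Z \<omega> * mart L \<omega> \<partial>P) = (\<Sum>i<L. \<integral>\<omega>. \<Delta>t / m * (?Z \<omega> * noise i \<omega>) \<partial>P)"
    unfolding eq using zn(1) by (intro Bochner_Integration.integral_sum integrable_mult_right) auto
  also have "\<dots> = 0"
    using zn(2) by (intro sum.neutral) (simp only: integral_mult_right_zero, simp)
  finally have zm0: "(\<integral>\<omega>. ?Z \<omega> * mart L \<omega> \<partial>P) = 0" .
  have taylor: "AE \<omega> in P. \<bar>\<phi> (en L \<omega>) - \<phi> (en 0 \<omega>) - ?Z \<omega> * mart L \<omega>\<bar>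
      \<le> A * (rem_const m M * (T * \<Delta>t)) * (1 + (bd \<omega>)\<^sup>2) + A * (en L \<omega> - en 0 \<omega>)\<^sup>2"
    using AE_path_bounds
  proof eventually_elim
    case (elim \<omega>)
    \<comment> \<open>On the reals the inner product is multiplication, so the Taylor bound for
      gradients applies to \<open>\<phi>\<close> as well.\<close>
    have "\<bar>\<phi> (en L \<omega>) - \<phi> (en 0 \<omega>) - ?Z \<omega> * (en L \<omega> - en 0 \<omega>)\<bar> \<le> A * (en L \<omega> - en 0 \<omega>)\<^sup>2"
      using GDERIV_lipschitz_taylor[of \<phi> \<phi>' A "en L \<omega>" "en 0 \<omega>"] der lip by simp
    moreover have "\<bar>?Z \<omega> * (en L \<omega> - en 0 \<omega> - mart L \<omega>)\<bar>
        \<le> A * (rem_const m M * (T * \<Delta>t) * (1 + (bd \<omega>)\<^sup>2))"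
      unfolding abs_mult using elim bounds(2) A by (intro mult_mono) auto
    ultimately show ?case
      by (simp add: algebra_simps)
  qed
  let ?D = "\<lambda>\<omega>. A * (rem_const m M * (T * \<Delta>t)) * (1 + (bd \<omega>)\<^sup>2) + A * (en L \<omega> - en 0 \<omega>)\<^sup>2"
  note sq = energy_error_second_moment[OF small]
  have b2: "integrable P (\<lambda>\<omega>. 1 + (bd \<omega>)\<^sup>2)"
    using bd_moments(3) by simp
  have D1: "integrable P (\<lambda>\<omega>. A * (rem_const m M * (T * \<Delta>t)) * (1 + (bd \<omega>)\<^sup>2))"
    by (intro integrable_mult_right b2)
  have D2: "integrable P (\<lambda>\<omega>. A * (en L \<omega> - en 0 \<omega>)\<^sup>2)"
    by (intro integrable_mult_right sq(1))
  have D: "integrable P ?D"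
    by (rule Bochner_Integration.integrable_add[OF D1 D2])
  have diff: "integrable P (\<lambda>\<omega>. \<phi> (en L \<omega>) - \<phi> (en 0 \<omega>) - ?Z \<omega> * mart L \<omega>)"
    using int zm by (rule Bochner_Integration.integrable_diff)
  have drop_mart: "(\<integral>\<omega>. \<phi> (en L \<omega>) - \<phi> (en 0 \<omega>) \<partial>P)
      = (\<integral>\<omega>. \<phi> (en L \<omega>) - \<phi> (en 0 \<omega>) - ?Z \<omega> * mart L \<omega> \<partial>P)"
    unfolding Bochner_Integration.integral_diff[OF int zm] zm0 by simp
  have "\<bar>\<integral>\<omega>. \<phi> (en L \<omega>) - \<phi> (en 0 \<omega>) \<partial>P\<bar>
      \<le> (\<integral>\<omega>. \<bar>\<phi> (en L \<omega>) - \<phi> (en 0 \<omega>) - ?Z \<omega> * mart L \<omega>\<bar> \<partial>P)"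
    unfolding drop_mart by (rule integral_abs_bound)
  also have "\<dots> \<le> (\<integral>\<omega>. ?D \<omega> \<partial>P)"
    by (rule integral_mono_AE[OF integrable_abs[OF diff] D taylor])
  also have "\<dots> = A * (rem_const m M * (T * \<Delta>t)) * (\<integral>\<omega>. 1 + (bd \<omega>)\<^sup>2 \<partial>P)
      + A * (\<integral>\<omega>. (en L \<omega> - en 0 \<omega>)\<^sup>2 \<partial>P)"
    unfolding Bochner_Integration.integral_add[OF D1 D2] integral_mult_right_zero by (rule refl)
  also have "\<dots> \<le> A * (rem_const m M * (T * \<Delta>t)) * (mom2 M * (1 + T\<^sup>2)) + A * (sq_const m M * Q)"
  proof -
    have "0 \<le> A * (rem_const m M * (T * \<Delta>t))"
      using A rem_const_nonneg T_pos \<Delta>t_pos by simp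
    from add_mono[OF mult_left_mono[OF bd_moments(4) this] mult_left_mono[OF sq(2) A]]
    show ?thesis unfolding Q_def .
  qed
  also have "\<dots> = A * (rem_const m M * mom2 M + sq_const m M) * Q"
    by (simp add: Q_def algebra_simps)
  finally show "\<bar>\<integral>\<omega>. \<phi> (en L \<omega>) - \<phi> (en 0 \<omega>) \<partial>P\<bar>
      \<le> A * (rem_const m M * mom2 M + sq_const m M) * (T * (1 + T\<^sup>2) * \<Delta>t)"
    by (simp add: Q_def)
qed

end

subsection \<open>Test functions and the error estimates\<close>

lemma Cb_smoothD:
  assumes "\<phi> \<in> Cb_smooth"
  shows "((deriv ^^ k) \<phi> has_field_derivative (deriv ^^ Suc k) \<phi> y) (at y)"
    and "\<exists>A. \<forall>y. \<bar>(deriv ^^ k) \<phi> y\<bar> \<le> A"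
proof -
  have "(deriv ^^ k) \<phi> differentiable (at y)"
    using assms by (simp add: Cb_smooth_def)
  then show "((deriv ^^ k) \<phi> has_field_derivative (deriv ^^ Suc k) \<phi> y) (at y)"
    by (simp add: DERIV_deriv_iff_real_differentiable)
  have "bounded (range ((deriv ^^ k) \<phi>))"
    using assms by (simp add: Cb_smooth_def)
  then show "\<exists>A. \<forall>y. \<bar>(deriv ^^ k) \<phi> y\<bar> \<le> A"
    by (auto simp: bounded_iff)
qed

lemma Cb_smooth_common_bound:
  assumes "\<phi> \<in> Cb_smooth"
  shows "\<exists>A>0. \<forall>y. \<bar>\<phi> y\<bar> \<le> A \<and> \<bar>deriv \<phi> y\<bar> \<le> A \<and> \<bar>deriv (deriv \<phi>) y\<bar> \<le> A"
proof -
  obtain a b c where abc: "\<And>y. \<bar>\<phi> y\<bar> \<le> a" "\<And>y. \<bar>deriv \<phi> y\<bar> \<le> b" "\<And>y. \<bar>deriv (deriv \<phi>) y\<bar> \<le> c"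
    using Cb_smoothD(2)[OF assms, of 0] Cb_smoothD(2)[OF assms, of 1] Cb_smoothD(2)[OF assms, of 2]
    by (auto simp: numeral_2_eq_2)
  define A where "A = 1 + max a (max b c)"
  have "\<bar>\<phi> y\<bar> \<le> A \<and> \<bar>deriv \<phi> y\<bar> \<le> A \<and> \<bar>deriv (deriv \<phi>) y\<bar> \<le> A" for y
    using abc[of y] by (auto simp: A_def)
  moreover have "A > 0"
    using abs_ge_zero[of "\<phi> 0"] abc(1)[of 0] by (auto simp: A_def)
  ultimately show ?thesis by blast
qed

text \<open>Chosen from \<open>\<phi>\<close> alone, because the constants must be fixed before the
  probability space, the potentials and the time step.\<close>

definition test_bound :: "(real \<Rightarrow> real) \<Rightarrow> real" where
  "test_bound \<phi> = (SOME A. A > 0 \<and>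
    (\<forall>y. \<bar>\<phi> y\<bar> \<le> A \<and> \<bar>deriv \<phi> y\<bar> \<le> A \<and> \<bar>deriv (deriv \<phi>) y\<bar> \<le> A))"

lemma test_bound:
  assumes "\<phi> \<in> Cb_smooth"
  shows "test_bound \<phi> > 0" "\<bar>\<phi> y\<bar> \<le> test_bound \<phi>" "\<bar>deriv \<phi> y\<bar> \<le> test_bound \<phi>"
    "\<bar>deriv (deriv \<phi>) y\<bar> \<le> test_bound \<phi>"
  using someI_ex[OF Cb_smooth_common_bound[OF assms, simplified Bex_def]]
  unfolding test_bound_def by blast+

context random_batch begin

text \<open>Conservation turns the full energy at \<open>T\<close> into \<open>en 0\<close> almost
  surely; measurability of \<open>x T\<close> and \<open>p T\<close> allows this replacement under
  the integrals.\<close>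

lemma random_batch_error:
  assumes small: "T * (1 + T\<^sup>2) * \<Delta>t \<le> 1"
    and meas: "x T \<in> borel_measurable P" "p T \<in> borel_measurable P"
    and full: "AE \<omega> in P. full_solution m V J \<psi> T (\<lambda>t. x t \<omega>) (\<lambda>t. p t \<omega>)
                    \<and> x 0 \<omega> = X0 \<omega> \<and> p 0 \<omega> = P0 \<omega>"
  defines "E \<equiv> \<lambda>\<omega>. energy (xb T \<omega>) (pb T \<omega>)" and "F \<equiv> \<lambda>\<omega>. energy (x T \<omega>) (p T \<omega>)"
  shows "integrable P (\<lambda>\<omega>. \<bar>E \<omega> - F \<omega>\<bar>\<^sup>2)"
    and "L2_norm P (\<lambda>\<omega>. E \<omega> - F \<omega>) \<le> (1 + \<bar>sq_const m M\<bar>) * sqrt (T * (1 + T\<^sup>2) * \<Delta>t)"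
    and "\<phi> \<in> Cb_smooth \<Longrightarrow> integrable P (\<lambda>\<omega>. \<phi> (E \<omega>) - \<phi> (F \<omega>))"
    and "\<phi> \<in> Cb_smooth \<Longrightarrow> \<bar>\<integral>\<omega>. \<phi> (E \<omega>) - \<phi> (F \<omega>) \<partial>P\<bar>
      \<le> test_bound \<phi> * (1 + \<bar>rem_const m M * mom2 M + sq_const m M\<bar>) * (T * (1 + T\<^sup>2) * \<Delta>t)"
proof -
  define Q where "Q = T * (1 + T\<^sup>2) * \<Delta>t"
  have Q: "Q \<ge> 0" using T_pos \<Delta>t_pos by (simp add: Q_def)
  \<comment> \<open>\<open>L \<ge> 1\<close> matters: \<open>gx 0\<close> and \<open>gp 0\<close>
    are the initial data rather than values of \<open>xb\<close> and \<open>pb\<close>.\<close>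
  have E: "E = en L"
    using L_pos by (auto simp: E_def en_def gx_def gp_def T_def)
  have F: "AE \<omega> in P. F \<omega> = en 0 \<omega>"
    using full
  proof eventually_elim
    case (elim \<omega>)
    then have "energy (x T \<omega>) (p T \<omega>) = energy (x 0 \<omega>) (p 0 \<omega>)"
      using full_solution_energy[of T "\<lambda>t. x t \<omega>" "\<lambda>t. p t \<omega>"] T_pos by simp
    then show ?case
      using elim by (simp add: F_def en_def gx_def gp_def)
  qed
  have F_meas: "F \<in> borel_measurable P"
    unfolding F_def using meas by (rule energy_measurable)
  have en_meas: "en L \<in> borel_measurable P" "en 0 \<in> borel_measurable P"
    by (auto intro: en_measurable_P)
  have AE_sq: "AE \<omega> in P. \<bar>E \<omega> - F \<omega>\<bar>\<^sup>2 = (en L \<omega> - en 0 \<omega>)\<^sup>2"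
    using F by eventually_elim (simp add: E)
  note sq = energy_error_second_moment[OF small]
  have sq_meas: "(\<lambda>\<omega>. \<bar>E \<omega> - F \<omega>\<bar>\<^sup>2) \<in> borel_measurable P"
    "(\<lambda>\<omega>. (en L \<omega> - en 0 \<omega>)\<^sup>2) \<in> borel_measurable P"
    using F_meas en_meas by (auto simp: E)
  show "integrable P (\<lambda>\<omega>. \<bar>E \<omega> - F \<omega>\<bar>\<^sup>2)"
    using sq(1) integrable_cong_AE[OF sq_meas AE_sq] by blast
  have "(\<integral>\<omega>. \<bar>E \<omega> - F \<omega>\<bar>\<^sup>2 \<partial>P) = (\<integral>\<omega>. (en L \<omega> - en 0 \<omega>)\<^sup>2 \<partial>P)"
    by (rule integral_cong_AE[OF sq_meas AE_sq])
  also have "\<dots> \<le> sq_const m M * Q"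
    using sq(2) by (simp add: Q_def)
  \<comment> \<open>A square dominating the constant lets the root be extracted exactly, and the
    summand 1 keeps the resulting \<open>C\<close> positive.\<close>
  also have "\<dots> \<le> (1 + \<bar>sq_const m M\<bar>)\<^sup>2 * Q"
  proof (rule mult_right_mono[OF _ Q])
    show "sq_const m M \<le> (1 + \<bar>sq_const m M\<bar>)\<^sup>2"
      using abs_ge_self[of "sq_const m M"] self_le_power[of "1 + \<bar>sq_const m M\<bar>" 2] by linarith
  qed
  finally have "sqrt (\<integral>\<omega>. \<bar>E \<omega> - F \<omega>\<bar>\<^sup>2 \<partial>P) \<le> sqrt ((1 + \<bar>sq_const m M\<bar>)\<^sup>2 * Q)"
    by (rule real_sqrt_le_mono)
  also have "\<dots> = (1 + \<bar>sq_const m M\<bar>) * sqrt Q"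
    by (simp add: real_sqrt_mult)
  finally show "L2_norm P (\<lambda>\<omega>. E \<omega> - F \<omega>) \<le> (1 + \<bar>sq_const m M\<bar>) * sqrt (T * (1 + T\<^sup>2) * \<Delta>t)"
    by (simp add: L2_norm_def Q_def)
  assume \<phi>: "\<phi> \<in> Cb_smooth"
  let ?A = "test_bound \<phi>"
  have d1: "(\<phi> has_field_derivative deriv \<phi> y) (at y)" for y
    using Cb_smoothD(1)[OF \<phi>, of 0] by simp
  have d2: "(deriv \<phi> has_field_derivative deriv (deriv \<phi>) y) (at y)" for y
    using Cb_smoothD(1)[OF \<phi>, of 1] by simp
  have cont: "continuous_on UNIV \<phi>" "continuous_on UNIV (deriv \<phi>)"
    using DERIV_isCont[OF d1] DERIV_isCont[OF d2] by (auto simp: continuous_on_eq_continuous_at)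
  have lip: "\<bar>deriv \<phi> z - deriv \<phi> y\<bar> \<le> ?A * \<bar>z - y\<bar>" for y z
    using field_differentiable_bound[of UNIV "deriv \<phi>" "deriv (deriv \<phi>)" ?A z y] d2 test_bound(4)[OF \<phi>]
    by simp
  note weak = weak_energy_error[OF small d1 test_bound(2)[OF \<phi>] test_bound(3)[OF \<phi>] lip
      borel_measurable_continuous_onI[OF cont(2)]]
  have AE_\<phi>: "AE \<omega> in P. \<phi> (E \<omega>) - \<phi> (F \<omega>) = \<phi> (en L \<omega>) - \<phi> (en 0 \<omega>)"
    using F by eventually_elim (simp add: E)
  note \<phi>_meas = measurable_compose[OF _ borel_measurable_continuous_onI[OF cont(1)]]
  have \<phi>_meas: "(\<lambda>\<omega>. \<phi> (E \<omega>) - \<phi> (F \<omega>)) \<in> borel_measurable P"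
    "(\<lambda>\<omega>. \<phi> (en L \<omega>) - \<phi> (en 0 \<omega>)) \<in> borel_measurable P"
    unfolding E using \<phi>_meas F_meas en_meas by (intro borel_measurable_diff; blast)+
  show "integrable P (\<lambda>\<omega>. \<phi> (E \<omega>) - \<phi> (F \<omega>))"
    using weak(1) integrable_cong_AE[OF \<phi>_meas AE_\<phi>] by blast
  have "\<bar>\<integral>\<omega>. \<phi> (E \<omega>) - \<phi> (F \<omega>) \<partial>P\<bar> \<le> ?A * (rem_const m M * mom2 M + sq_const m M) * Q"
    using weak(2) unfolding Q_def integral_cong_AE[OF \<phi>_meas AE_\<phi>] .
  also have "\<dots> \<le> ?A * (1 + \<bar>rem_const m M * mom2 M + sq_const m M\<bar>) * Q"
    using test_bound(1)[OF \<phi>] Q by (intro mult_right_mono mult_left_mono) auto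
  finally show "\<bar>\<integral>\<omega>. \<phi> (E \<omega>) - \<phi> (F \<omega>) \<partial>P\<bar>
      \<le> ?A * (1 + \<bar>rem_const m M * mom2 M + sq_const m M\<bar>) * (T * (1 + T\<^sup>2) * \<Delta>t)"
    unfolding Q_def .
qed

end

theorem theorem3p1:
  fixes m M :: real and s :: nat
  assumes "m > 0" and "s \<ge> 1"
  shows "\<exists>c0>0. \<exists>C>0. \<exists>C\<phi> :: (real \<Rightarrow> real) \<Rightarrow> real.
    (\<forall>\<phi>\<in>Cb_smooth. C\<phi> \<phi> > 0) \<and>
    (\<forall>(P :: 'w measure) (J :: nat set) (V :: real^'n \<Rightarrow> real) (\<psi> :: nat \<Rightarrow> real^'n \<Rightarrow> real)
      (L :: nat) (\<Delta>t :: real) (T :: real) (X0 :: 'w \<Rightarrow> real^'n) (P0 :: 'w \<Rightarrow> real^'n)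
      (\<xi> :: nat \<Rightarrow> 'w \<Rightarrow> nat set)
      (x :: real \<Rightarrow> 'w \<Rightarrow> real^'n) (p :: real \<Rightarrow> 'w \<Rightarrow> real^'n)
      (xb :: real \<Rightarrow> 'w \<Rightarrow> real^'n) (pb :: real \<Rightarrow> 'w \<Rightarrow> real^'n).
      prob_space P \<longrightarrow>
      finite J \<longrightarrow> card J \<ge> s \<longrightarrow>
      C1_fun V \<longrightarrow> (\<forall>y. norm (grad V y) \<le> M) \<longrightarrow>
      (\<forall>j\<in>J. C2_fun (\<psi> j) \<and> (\<forall>y. norm (grad (\<psi> j) y) \<le> M)
                  \<and> (\<forall>y. onorm ((*v) (hess (\<psi> j) y)) \<le> M)) \<longrightarrow>
      L \<ge> 1 \<longrightarrow> \<Delta>t > 0 \<longrightarrow> T = real L * \<Delta>t \<longrightarrow> T * (1 + T\<^sup>2) * \<Delta>t \<le> c0 \<longrightarrow>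
      X0 \<in> borel_measurable P \<longrightarrow> P0 \<in> borel_measurable P \<longrightarrow>
      prob_space.indep_var P borel X0 borel P0 \<longrightarrow>
      integrable P (\<lambda>\<omega>. norm (P0 \<omega>) ^ 4) \<longrightarrow> (\<integral>\<omega>. norm (P0 \<omega>) ^ 4 \<partial>P) \<le> M \<longrightarrow>
      random_batches P J s L X0 P0 \<xi> \<longrightarrow>
      (\<forall>t\<in>{0..T}. x t \<in> borel_measurable P \<and> p t \<in> borel_measurable P) \<longrightarrow>
      (AE \<omega> in P. full_solution m V J \<psi> T (\<lambda>t. x t \<omega>) (\<lambda>t. p t \<omega>)
                    \<and> x 0 \<omega> = X0 \<omega> \<and> p 0 \<omega> = P0 \<omega>) \<longrightarrow>
      adapted_batch P J X0 P0 \<xi> L \<Delta>t xb \<longrightarrow> adapted_batch P J X0 P0 \<xi> L \<Delta>t pb \<longrightarrow>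
      (AE \<omega> in P. batch_solution m V \<psi> s L \<Delta>t (\<lambda>l. \<xi> l \<omega>) (\<lambda>t. xb t \<omega>) (\<lambda>t. pb t \<omega>)
                    \<and> xb 0 \<omega> = X0 \<omega> \<and> pb 0 \<omega> = P0 \<omega>) \<longrightarrow>
      (integrable P (\<lambda>\<omega>. \<bar>Ham m V J \<psi> (xb T \<omega>) (pb T \<omega>) - Ham m V J \<psi> (x T \<omega>) (p T \<omega>)\<bar>\<^sup>2) \<and>
       L2_norm P (\<lambda>\<omega>. Ham m V J \<psi> (xb T \<omega>) (pb T \<omega>) - Ham m V J \<psi> (x T \<omega>) (p T \<omega>))
         \<le> C * sqrt (T * (1 + T\<^sup>2) * \<Delta>t)) \<and>
      (\<forall>\<phi>\<in>Cb_smooth.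
         integrable P (\<lambda>\<omega>. \<phi> (Ham m V J \<psi> (xb T \<omega>) (pb T \<omega>)) - \<phi> (Ham m V J \<psi> (x T \<omega>) (p T \<omega>))) \<and>
         \<bar>\<integral>\<omega>. \<phi> (Ham m V J \<psi> (xb T \<omega>) (pb T \<omega>)) - \<phi> (Ham m V J \<psi> (x T \<omega>) (p T \<omega>)) \<partial>P\<bar>
           \<le> C\<phi> \<phi> * (T * (1 + T\<^sup>2) * \<Delta>t)))"
proof -
  define C where "C = 1 + \<bar>sq_const m M\<bar>"
  define C\<phi> where "C\<phi> \<phi> = test_bound \<phi> * (1 + \<bar>rem_const m M * mom2 M + sq_const m M\<bar>)" for \<phi>
  have C_pos: "C > 0"
    by (simp add: C_def add_pos_nonneg)
  have C\<phi>_pos: "\<forall>\<phi>\<in>Cb_smooth. C\<phi> \<phi> > 0"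
    using test_bound(1) by (simp add: C\<phi>_def add_pos_nonneg)
  \<comment> \<open>The witness 1 for \<open>c0\<close> is the threshold under which Q^2 \<le>
    Q.\<close>
  show ?thesis
  proof (rule exI[of _ 1], rule conjI[OF zero_less_one], rule exI[of _ C], rule conjI[OF C_pos],
      rule exI[of _ C\<phi>], rule conjI[OF C\<phi>_pos], intro allI impI, goal_cases)
    case (1 P J V \<psi> L \<Delta>t T X0 P0 \<xi> x p xb pb)
    interpret prob_space P by (rule 1(1))
    interpret random_batch m M s J V \<psi> P L \<Delta>t X0 P0 \<xi> xb pb
      by unfold_locales (use 1 assms in auto)
    have T: "random_batch.T L \<Delta>t = T"
      using 1 by (simp add: T_def)
    have small: "T * (1 + T\<^sup>2) * \<Delta>t \<le> 1" and meas: "x T \<in> borel_measurable P" "p T \<in> borel_measurable P"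
      using 1 T_pos unfolding T by auto
    \<comment> \<open>\<open>1(18)\<close> is the almost sure statement that \<open>x\<close> and
      \<open>p\<close> solve the full system with the given initial data.\<close>
    note error = random_batch_error[of x p, unfolded T, OF small meas 1(18)]
    show ?case
      unfolding C_def C\<phi>_def using error by blast
  qed
qed

end
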